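(* Fix a uniformity $r \ge 2$ and a residue class $k \not\equiv 0 \pmod r$. If $r$ is even and $S_i \times S_{r-i}$ is available for $\mathcal{C}_{\equiv k}^r\text{-}\mathrm{hom}$ for every odd $i \in [1,r-1]$, then $\gamma(\mathcal{C}_{\equiv k}^r\text{-}\mathrm{hom}) = 1/2$. Otherwise, $\gamma(\mathcal{C}_{\equiv k}^r\text{-}\mathrm{hom}) \le 1/3$.
   Context: An $r$-graph is an $r$-uniform hypergraph; $\delta_{r-1}(\mathcal{H})$ is the minimum number of edges containing an $(r-1)$-set of vertices. For a family $\mathcal{F}$, $\mathrm{ex}_{r-1}(n,\mathcal{F})$ is the maximum of $\delta_{r-1}(\mathcal{H})$ over $n$-vertex $r$-graphs containing no member of $\mathcal{F}$, and $\gamma(\mathcal{F}) = \lim_{n\to\infty}\mathrm{ex}_{r-1}(n,\mathcal{F})/n$. $\mathcal{C}_\ell^r$ ($\ell>r$) is the tight cycle on $\{0,\ldots,\ell-1\}$ with edges $\{i,\ldots,i+r-1\}$ modulo $\ell$; $\mathcal{C}_{\equiv k}^r$ is the family of tight cycles with $\ell\equiv k \pmod r$; $\mathcal{F}\text{-}\mathrm{hom}$ is the family of homomorphic images of members of $\mathcal{F}$ (images under edge-preserving vertex maps that are surjective on edges). Let $\mathrm{cyc}=(1\,2\,\cdots\,r)\in S_r$. A subgroup of $S_r$ is $\mathrm{cyc}^k$-conjugate avoiding if it contains no conjugate of $\mathrm{cyc}^k$. For $1\le i\le r-1$, $S_i\times S_{r-i}$ denotes the subgroup of $S_r$ of permutations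 preserving $\{1,\ldots,i\}$ and $\{i+1,\ldots,r\}$; it is available for $\mathcal{C}_{\equiv k}^r\text{-}\mathrm{hom}$ if it (or a conjugate of it) is a maximal $\mathrm{cyc}^k$-conjugate avoiding subgroup of $S_r$. *)

theory Defs
  imports Complex_Main "HOL-Number_Theory.Cong" "HOL-Algebra.Sym_Groups"
begin

record 'a hypergraph =
  verts :: "'a set"
  edges :: "'a set set"

definition r_graph :: "nat \<Rightarrow> 'a hypergraph \<Rightarrow> bool" where
  "r_graph r H \<longleftrightarrow> finite (verts H) \<and> (\<forall>e\<in>edges H. e \<subseteq> verts H \<and> card e = r)"

definition hypergraph_hom :: "('a \<Rightarrow> 'b) \<Rightarrow> 'a hypergraph \<Rightarrow> 'b hypergraph \<Rightarrow> bool" where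
  "hypergraph_hom \<phi> F G \<longleftrightarrow> \<phi> ` verts F \<subseteq> verts G \<and> (\<forall>e\<in>edges F. \<phi> ` e \<in> edges G)"

text \<open>Containment as a (not necessarily induced) subhypergraph, up to isomorphism.\<close>

definition contains_copy :: "'b hypergraph \<Rightarrow> 'a hypergraph \<Rightarrow> bool" where
  "contains_copy H F \<longleftrightarrow> (\<exists>\<phi>. inj_on \<phi> (verts F) \<and> hypergraph_hom \<phi> F H)"

definition family_free :: "'a hypergraph set \<Rightarrow> 'b hypergraph \<Rightarrow> bool" where
  "family_free \<F> H \<longleftrightarrow> (\<forall>F\<in>\<F>. \<not> contains_copy H F)"

text \<open>Below, \<open>Min\<close> is taken over a nonempty set as soon as \<open>H\<close> has at least \<open>r - 1\<close> vertices; for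
  fewer vertices the value is an unspecified constant, which does not affect limits.\<close>

definition min_codegree :: "nat \<Rightarrow> 'a hypergraph \<Rightarrow> nat" where
  "min_codegree r H =
     Min {card {e \<in> edges H. S \<subseteq> e} | S. S \<subseteq> verts H \<and> card S = r - 1}"

text \<open>Every finite hypergraph is isomorphic to one with vertices in \<open>nat\<close>, so it suffices to
  consider host graphs and families on that type.\<close>

definition codegree_ex :: "nat \<Rightarrow> nat \<Rightarrow> nat hypergraph set \<Rightarrow> nat" where
  "codegree_ex r n \<F> =
     Max {min_codegree r H | H :: nat hypergraph.
            r_graph r H \<and> card (verts H) = n \<and> family_free \<F> H}"

definition codegree_ratio :: "nat \<Rightarrow> nat hypergraph set \<Rightarrow> nat \<Rightarrow> real" where
  "codegree_ratio r \<F> n = real (codegree_ex r n \<F>) / real n"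

definition codegree_density :: "nat \<Rightarrow> nat hypergraph set \<Rightarrow> real" where
  "codegree_density r \<F> = lim (codegree_ratio r \<F>)"

definition tight_cycle :: "nat \<Rightarrow> nat \<Rightarrow> nat hypergraph" where
  "tight_cycle r l =
     \<lparr> verts = {0..<l}, edges = {(\<lambda>j. (i + j) mod l) ` {0..<r} | i. i < l} \<rparr>"

definition tight_cycle_family :: "nat \<Rightarrow> nat \<Rightarrow> nat hypergraph set" where
  "tight_cycle_family r k = {tight_cycle r l | l. l > r \<and> [l = k] (mod r)}"

text \<open>The images are required to be \<open>r\<close>-graphs, so the vertex maps are injective on every edge.\<close>

definition hom_family :: "nat \<Rightarrow> nat hypergraph set \<Rightarrow> nat hypergraph set" where
  "hom_family r \<F> =
     {G. r_graph r G \<and>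
         (\<exists>F\<in>\<F>. \<exists>\<phi>. hypergraph_hom \<phi> F G \<and> verts G = \<phi> ` verts F \<and>
                     edges G = (\<lambda>e. \<phi> ` e) ` edges F)}"

definition cyc :: "nat \<Rightarrow> nat \<Rightarrow> nat" where
  "cyc r = cycle_of_list [1..<Suc r]"

definition conjugate_avoiding :: "nat \<Rightarrow> (nat \<Rightarrow> nat) \<Rightarrow> (nat \<Rightarrow> nat) set \<Rightarrow> bool" where
  "conjugate_avoiding r x H \<longleftrightarrow>
     subgroup H (sym_group r) \<and>
     (\<forall>g\<in>carrier (sym_group r).
        g \<otimes>\<^bsub>sym_group r\<^esub> x \<otimes>\<^bsub>sym_group r\<^esub> inv\<^bsub>sym_group r\<^esub> g \<notin> H)"

definition maximal_conjugate_avoiding :: "nat \<Rightarrow> (nat \<Rightarrow> nat) \<Rightarrow> (nat \<Rightarrow> nat) set \<Rightarrow> bool" where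
  "maximal_conjugate_avoiding r x H \<longleftrightarrow>
     conjugate_avoiding r x H \<and> (\<forall>K. conjugate_avoiding r x K \<and> H \<subseteq> K \<longrightarrow> K = H)"

definition young_subgroup :: "nat \<Rightarrow> nat \<Rightarrow> (nat \<Rightarrow> nat) set" where
  "young_subgroup r i =
     {p \<in> carrier (sym_group r). p ` {1..i} = {1..i} \<and> p ` {Suc i..r} = {Suc i..r}}"

definition available :: "nat \<Rightarrow> nat \<Rightarrow> nat \<Rightarrow> bool" where
  "available r k i \<longleftrightarrow>
     (\<exists>g\<in>carrier (sym_group r).
        maximal_conjugate_avoiding r (cyc r [^]\<^bsub>sym_group r\<^esub> k)
          (g <#\<^bsub>sym_group r\<^esub> young_subgroup r i #>\<^bsub>sym_group r\<^esub> inv\<^bsub>sym_group r\<^esub> g))"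

end

theory Submission
  imports Defs "HOL-Library.Extended_Real" "HOL-Real_Asymp.Real_Asymp"
begin

text \<open>
  Let \<open>d = r div gcd r k\<close>; the permutation \<open>cyc\<^sup>k\<close> consists of \<open>d\<close>-cycles, so \<open>S\<^sub>i \<times> S\<^sub>r\<^sub>-\<^sub>i\<close> contains a
  conjugate of it iff \<open>d dvd i\<close>, and all odd \<open>i\<close> are available iff \<open>d\<close> is even.

  Replacing one vertex of an ordered edge by another one costs \<open>r\<close> steps of a tight walk. Hence a host
  is free iff no ordered edge can be turned into its rotation by \<open>k\<close> by such replacements. If the link
  graph of \<open>e - {a, b}\<close> has an odd cycle, then \<open>a\<close> and \<open>b\<close> can be interchanged in the ordered edge \<open>e\<close>.

  If all codegrees exceed \<open>n/2\<close>, every link graph contains a triangle and all permutations of an edge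
  are reachable. For even \<open>d\<close> the edges that meet half of the vertices in an odd number of points show
  that this is optimal.

  If all codegrees exceed \<open>n/3\<close>, then among three vertices of an edge \<open>e\<close> two can be interchanged, since
  two of the three neighbourhoods of \<open>e - {a}\<close> intersect. So every edge splits into two blocks inside
  which all permutations are reachable, and in a free host no block size is a multiple of \<open>d\<close>. Passing
  to another component of the link graph of \<open>e - {x, x'}\<close>, with \<open>x\<close> and \<open>x'\<close> in one block, shrinks that
  block by exactly two. For odd \<open>d\<close> this leads to a block of size \<open>0\<close> or \<open>d\<close>, a contradiction.

  The limit exists because a random small sample of vertices of a large host almost preserves all
  relative codegrees.
\<close>

subsection \<open>Tight walks and replacements\<close>

definition nbrs :: "'a set set \<Rightarrow> 'a set \<Rightarrow> 'a set" where
  "nbrs E S = {v. v \<notin> S \<and> insert v S \<in> E}"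

text \<open>Lists stand for ordered edges: when all edges have \<open>r\<close> elements, a list of
  length \<open>r\<close> whose set is an edge is distinct. At most the coordinate \<open>j\<close>
  changes.\<close>

definition repl :: "nat \<Rightarrow> 'a set set \<Rightarrow> ('a list \<times> 'a list) set" where
  "repl r E = {(xs, ys). length xs = r \<and> length ys = r \<and> set xs \<in> E \<and> set ys \<in> E \<and>
     (\<exists>j<r. \<forall>i<r. i \<noteq> j \<longrightarrow> xs ! i = ys ! i)}"

text \<open>One shift of the window of a tight walk. The new vertex \<open>v\<close> may be the one
  just dropped; then the walk turns around inside a single edge, which is
  \<open>rotate1\<close>.\<close>

definition tight_step :: "nat \<Rightarrow> 'a set set \<Rightarrow> ('a list \<times> 'a list) set" where
  "tight_step r E = {(xs, ys). length xs = r \<and> set xs \<in> E \<and> set ys \<in> E \<and> (\<exists>v. ys = tl xs @ [v])}"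

lemma tight_step_rotate:
  assumes "length xs = r" "set xs \<in> E" "r > 0"
  shows "(xs, rotate n xs) \<in> tight_step r E ^^ n"
proof (induction n)
  case (Suc n)
  have ne: "rotate n xs \<noteq> []" using assms by auto
  have "rotate (Suc n) xs = tl (rotate n xs) @ [hd (rotate n xs)]"
    using ne by (simp add: rotate1_hd_tl)
  hence "(rotate n xs, rotate (Suc n) xs) \<in> tight_step r E"
    using assms unfolding tight_step_def
    by (metis (mono_tags, lifting) case_prodI length_rotate mem_Collect_eq set_rotate)
  with Suc show ?case by auto
qed simp

text \<open>After \<open>j\<close> rotations the coordinate to be replaced is in front, one step
  exchanges it, and \<open>r - Suc j\<close> rotations restore the order. The total is
  \<open>r\<close>, so replacements do not affect the length of a walk modulo
  \<open>r\<close>.\<close>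

lemma tight_step_of_repl:
  assumes "(xs, ys) \<in> repl r E"
  shows "(xs, ys) \<in> tight_step r E ^^ r"
proof -
  from assms obtain j where j: "j < r" "\<And>i. i < r \<Longrightarrow> i \<noteq> j \<Longrightarrow> xs ! i = ys ! i"
    and l: "length xs = r" "length ys = r" "set xs \<in> E" "set ys \<in> E"
    unfolding repl_def by auto
  have d: "drop (Suc j) xs = drop (Suc j) ys" and t: "take j xs = take j ys"
    using j l by (auto intro!: nth_equalityI)
  have rx: "rotate j xs = xs ! j # drop (Suc j) xs @ take j xs"
    using j l by (simp add: rotate_drop_take Cons_nth_drop_Suc)
  have ry: "rotate j ys = ys ! j # drop (Suc j) ys @ take j ys"
    using j l by (simp add: rotate_drop_take Cons_nth_drop_Suc)
  have "rotate (Suc j) ys = tl (rotate j xs) @ [ys ! j]"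
    using rx ry d t by simp
  hence s: "(rotate j xs, rotate (Suc j) ys) \<in> tight_step r E"
    using l unfolding tight_step_def
    by (metis (mono_tags, lifting) case_prodI length_rotate mem_Collect_eq set_rotate)
  have 1: "(xs, rotate j xs) \<in> tight_step r E ^^ j"
    using tight_step_rotate l j by (metis gr_zeroI not_less_zero)
  have 2: "(xs, rotate (Suc j) ys) \<in> tight_step r E ^^ Suc j"
    using 1 s by auto
  have 3: "(rotate (Suc j) ys, rotate (r - Suc j) (rotate (Suc j) ys)) \<in> tight_step r E ^^ (r - Suc j)"
    using l j by (intro tight_step_rotate) auto
  have "rotate (r - Suc j) (rotate (Suc j) ys) = rotate r ys"
    using j by (simp add: rotate_rotate del: rotate_Suc)
  also have "\<dots> = ys" using l by (metis rotate_id mod_self)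
  finally have "(rotate (Suc j) ys, ys) \<in> tight_step r E ^^ (r - Suc j)" using 3 by simp
  with 2 have "(xs, ys) \<in> tight_step r E ^^ (Suc j + (r - Suc j))"
    unfolding relpow_add by blast
  thus ?thesis using j by simp
qed

lemma tight_steps_of_repl_rtrancl:
  assumes "(xs, ys) \<in> (repl r E)\<^sup>*"
  shows "\<exists>m. (xs, ys) \<in> tight_step r E ^^ (m * r)"
  using assms
proof (induction rule: rtrancl_induct)
  case base
  show ?case by (rule exI[of _ 0]) simp
next
  case (step ys zs)
  then obtain m where m: "(xs, ys) \<in> tight_step r E ^^ (m * r)" by blast
  have "(xs, zs) \<in> tight_step r E ^^ (m * r + r)"
    using m tight_step_of_repl[OF step(2)] unfolding relpow_add by blast
  thus ?case by (intro exI[of _ "Suc m"]) (simp add: add.commute)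
qed

lemma sym_repl: "sym (repl r E)"
  unfolding sym_def repl_def by fastforce

lemma repl_rtrancl_sym: "(xs, ys) \<in> (repl r E)\<^sup>* \<Longrightarrow> (ys, xs) \<in> (repl r E)\<^sup>*"
  by (meson sym_repl sym_rtrancl symD)

section \<open>Freeness in terms of homomorphisms and closed tight walks\<close>

lemma free_iff_no_tight_cycle_hom:
  fixes H :: "nat hypergraph"
  assumes H: "r_graph r H"
  shows "family_free (hom_family r (tight_cycle_family r k)) H \<longleftrightarrow>
    \<not> (\<exists>l \<phi>. l > r \<and> [l = k] (mod r) \<and> hypergraph_hom \<phi> (tight_cycle r l) H)"
proof
  assume free: "family_free (hom_family r (tight_cycle_family r k)) H"
  show "\<not> (\<exists>l \<phi>. l > r \<and> [l = k] (mod r) \<and> hypergraph_hom \<phi> (tight_cycle r l) H)"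
  proof clarify
    fix l \<phi> assume l: "l > r" "[l = k] (mod r)"
    and hom: "hypergraph_hom \<phi> (tight_cycle r l) H"
    define C where "C = tight_cycle r l"
    have Ce: "e \<in> edges C \<Longrightarrow> \<phi> ` e \<in> edges H" for e
      using hom unfolding C_def hypergraph_hom_def by blast
    have vsub: "\<phi> ` verts C \<subseteq> verts H" using hom unfolding C_def hypergraph_hom_def
      by blast
    have esub: "e \<in> edges C \<Longrightarrow> e \<subseteq> verts C" for e
      unfolding C_def tight_cycle_def using l by auto
    have fin: "finite (verts C)" unfolding C_def tight_cycle_def by simp
    \<comment> \<open>The image of the cycle inside \<open>H\<close>. Its edges are edges of
      \<open>H\<close>, hence have \<open>r\<close> elements, so it is an \<open>r\<close>-graph as
      \<open>hom_family\<close> demands.\<close>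
    define G where "G = \<lparr> verts = \<phi> ` verts C, edges = (\<lambda>e. \<phi> ` e) ` edges C \<rparr>"
    have "r_graph r G" using esub Ce H fin unfolding r_graph_def G_def by auto
    moreover have "C \<in> tight_cycle_family r k" unfolding tight_cycle_family_def C_def using l
      by auto
    moreover have "hypergraph_hom \<phi> C G" unfolding hypergraph_hom_def G_def by auto
    ultimately have "G \<in> hom_family r (tight_cycle_family r k)"
      unfolding hom_family_def by (auto simp: G_def)
    moreover have "contains_copy H G" unfolding contains_copy_def hypergraph_hom_def G_def
      using vsub Ce by (intro exI[of _ id]) auto
    ultimately show False using free unfolding family_free_def by blast
  qed
next
  assume no: "\<not> (\<exists>l \<phi>. l > r \<and> [l = k] (mod r) \<and> hypergraph_hom \<phi> (tight_cycle r l) H)"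
  show "family_free (hom_family r (tight_cycle_family r k)) H"
    unfolding family_free_def
  proof clarify
    fix G assume "G \<in> hom_family r (tight_cycle_family r k)" "contains_copy H G"
    then obtain l \<phi> \<psi> where l: "l > r" "[l = k] (mod r)" and
      h: "hypergraph_hom \<phi> (tight_cycle r l) G" "hypergraph_hom \<psi> G H"
      unfolding hom_family_def tight_cycle_family_def contains_copy_def by auto
    have "hypergraph_hom (\<psi> \<circ> \<phi>) (tight_cycle r l) H"
      using h unfolding hypergraph_hom_def image_comp[symmetric] by blast
    thus False using no l by blast
  qed
qed

text \<open>The first vertices of the successive windows define the homomorphism: entry
  \<open>j\<close> of a window is the first entry of the window \<open>j\<close> steps later, so
  each edge of the cycle is sent to a window of the walk.\<close>

lemma not_free_of_closed_tight_walk: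
  fixes H :: "nat hypergraph"
  assumes H: "r_graph r H" and r: "r > 0"
    and w: "(xs, xs) \<in> tight_step r (edges H) ^^ l" and l: "l > r" "[l = k] (mod r)"
  shows "\<not> family_free (hom_family r (tight_cycle_family r k)) H"
proof -
  from w obtain f where f: "f 0 = xs" "f l = xs" "\<And>i. i < l \<Longrightarrow> (f i, f (Suc i)) \<in> tight_step r (edges H)"
    unfolding relpow_fun_conv by blast
  \<comment> \<open>Periodic continuation, so that windows wrapping around the end of the walk need
    no separate treatment.\<close>
  define F where "F i = f (i mod l)" for i
  have Fs: "(F i, F (Suc i)) \<in> tight_step r (edges H)" for i
  proof (cases "Suc (i mod l) = l")
    case True
    hence "Suc i mod l = 0" by (simp add: mod_Suc)
    thus ?thesis using f(3)[of "i mod l"] True f(1,2) l unfolding F_def by simp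
  next
    case False
    hence "Suc i mod l = Suc (i mod l)" by (simp add: mod_Suc)
    thus ?thesis using f(3)[of "i mod l"] l unfolding F_def by simp
  qed
  have len: "length (F i) = r" and Fe: "set (F i) \<in> edges H" for i
    using Fs[of i] unfolding tight_step_def by auto
  have nth: "j < r \<Longrightarrow> F i ! j = hd (F (i + j))" for i j
  proof (induction j arbitrary: i)
    case 0
    have "F i \<noteq> []" using len[of i] r by auto
    thus ?case by (simp add: hd_conv_nth)
  next
    case (Suc j)
    obtain v where v: "F (Suc i) = tl (F i) @ [v]" using Fs[of i] unfolding tight_step_def by auto
    have "F (Suc i) ! j = F i ! Suc j"
      unfolding v using Suc.prems len[of i] by (auto simp: nth_append nth_tl)
    thus ?case using Suc.IH[of "Suc i"] Suc.prems by simp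
  qed
  define \<phi> where "\<phi> i = hd (f i)" for i
  have win: "\<phi> ` (\<lambda>j. (i + j) mod l) ` {0..<r} = set (F i)" for i
  proof -
    have "\<phi> ` (\<lambda>j. (i + j) mod l) ` {0..<r} = (\<lambda>j. F i ! j) ` {0..<r}"
      unfolding image_image
      by (rule image_cong) (use nth[of _ i] in \<open>auto simp: \<phi>_def F_def\<close>)
    also have "\<dots> = set (F i)" using len[of i] by (auto simp: set_conv_nth)
    finally show ?thesis .
  qed
  have "\<phi> ` {0..<l} \<subseteq> verts H"
  proof
    fix v assume "v \<in> \<phi> ` {0..<l}"
    then obtain i where i: "i < l" "v = \<phi> i" by auto
    have "\<phi> i = F i ! 0" using nth[of 0 i] r i by (simp add: \<phi>_def F_def)
    hence "v \<in> set (F i)" using i len[of i] r by simp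
    thus "v \<in> verts H" using H Fe unfolding r_graph_def by blast
  qed
  hence "hypergraph_hom \<phi> (tight_cycle r l) H"
    unfolding hypergraph_hom_def tight_cycle_def using win Fe by auto
  thus ?thesis unfolding free_iff_no_tight_cycle_hom[OF H] using l by blast
qed

text \<open>Rotating by \<open>k\<close> takes \<open>k\<close> steps, and the reversed replacements
  lead back in a multiple of \<open>r\<close> steps; this closes a walk of length \<open>k\<close>
  modulo \<open>r\<close>.\<close>

lemma not_free_of_repl_rotate:
  fixes H :: "nat hypergraph"
  assumes H: "r_graph r H" and r: "r > 0"
    and xs: "length xs = r" "set xs \<in> edges H"
    and w: "(xs, rotate k xs) \<in> (repl r (edges H))\<^sup>*"
    and k: "k > 0"
  shows "\<not> family_free (hom_family r (tight_cycle_family r k)) H"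
proof -
  let ?R = "tight_step r (edges H)"
  obtain m where m: "(rotate k xs, xs) \<in> ?R ^^ (m * r)"
    using tight_steps_of_repl_rtrancl[OF repl_rtrancl_sym[OF w]] by blast
  \<comment> \<open>One additional full turn, because the family only contains cycles longer than
    \<open>r\<close> and \<open>k + m * r\<close> may be too short.\<close>
  have a: "(xs, xs) \<in> ?R ^^ r"
    using tight_step_rotate[OF xs r, of r] xs by (metis rotate_id mod_self)
  have b: "(xs, rotate k xs) \<in> ?R ^^ k" using tight_step_rotate[OF xs r] .
  have "(xs, xs) \<in> ?R ^^ (r + (k + m * r))"
    unfolding relpow_add using a b m by blast
  moreover have "[r + (k + m * r) = k] (mod r)" by (simp add: Cong.cong_def)
  ultimately show ?thesis using not_free_of_closed_tight_walk[OF H r] k by simp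
qed

lemma repl_nth:
  assumes "length xs = r" "length ys = r" "set xs \<in> E" "set ys \<in> E" "j < r"
    "\<And>i. i < r \<Longrightarrow> i \<noteq> j \<Longrightarrow> xs ! i = ys ! i"
  shows "(xs, ys) \<in> repl r E"
  using assms unfolding repl_def by auto

section \<open>Permutations of an edge realised by replacements\<close>

definition edge_group :: "nat \<Rightarrow> 'a set set \<Rightarrow> 'a set \<Rightarrow> ('a \<Rightarrow> 'a) set" where
  "edge_group r E e = {p. p permutes e \<and>
     (\<forall>xs. length xs = r \<longrightarrow> set xs = e \<longrightarrow> (xs, map p xs) \<in> (repl r E)\<^sup>*)}"

lemma edge_group_id: "id \<in> edge_group r E e"
  unfolding edge_group_def by (auto simp: permutes_id)

text \<open>\<open>edge_group\<close> quantifies over all orderings of \<open>e\<close> precisely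
  for this: \<open>p\<close> is applied to the ordering \<open>map q xs\<close> that
  \<open>q\<close> has produced.\<close>

lemma edge_group_comp:
  assumes "p \<in> edge_group r E e" "q \<in> edge_group r E e"
  shows "p \<circ> q \<in> edge_group r E e"
proof -
  have pe: "p permutes e" "q permutes e" using assms unfolding edge_group_def by auto
  have "(xs, map (p \<circ> q) xs) \<in> (repl r E)\<^sup>*" if "length xs = r" "set xs = e" for xs
  proof -
    have "(xs, map q xs) \<in> (repl r E)\<^sup>*" using assms that unfolding edge_group_def by auto
    moreover have "(map q xs, map p (map q xs)) \<in> (repl r E)\<^sup>*"
      using assms that permutes_image[OF pe(2)] unfolding edge_group_def
      by (auto simp del: map_map)
    ultimately show ?thesis by simp
  qed
  thus ?thesis using permutes_compose[OF pe(2,1)] unfolding edge_group_def by auto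
qed

lemma edge_group_permutes:
  assumes "finite A" "p permutes A"
    and "\<And>a b. a \<in> A \<Longrightarrow> b \<in> A \<Longrightarrow> a \<noteq> b \<Longrightarrow> transpose a b \<in> edge_group r E e"
  shows "p \<in> edge_group r E e"
  using assms(2,1)
proof (induction rule: permutes_induct)
  case id
  show ?case by (rule edge_group_id)
next
  case (swap a b p)
  thus ?case using assms(3) edge_group_comp by blast
qed

text \<open>A permutation preserving \<open>P\<close> is the product of its restrictions to
  \<open>P\<close> and to \<open>e - P\<close>, and each of these is generated by transpositions
  inside one block.\<close>

lemma edge_group_block:
  assumes e: "finite e" "P \<subseteq> e"
    and tr: "\<And>a b. a \<in> e \<Longrightarrow> b \<in> e \<Longrightarrow> a \<noteq> b \<Longrightarrow> (a \<in> P \<longleftrightarrow> b \<in> P) \<Longrightarrow> transpose a b \<in> edge_group r E e"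
    and p: "p permutes e" "\<And>a. a \<in> e \<Longrightarrow> p a \<in> P \<longleftrightarrow> a \<in> P"
  shows "p \<in> edge_group r E e"
proof -
  have fin: "finite P" "finite (e - P)" using e finite_subset by auto
  have inj: "inj p" using p(1) permutes_inj by blast
  have im: "p ` P \<subseteq> P" "p ` (e - P) \<subseteq> e - P"
    using p e permutes_in_image[OF p(1)] by auto
  have bP: "bij_betw p P P" "bij_betw p (e - P) (e - P)"
    by (simp_all add: bij_betw_def inj_on_subset[OF inj] endo_inj_surj[OF fin(1) im(1)]
        endo_inj_surj[OF fin(2) im(2)])
  define p1 where "p1 x = (if x \<in> P then p x else x)" for x
  define p2 where "p2 x = (if x \<in> e - P then p x else x)" for x
  have "p1 permutes P" unfolding p1_def
    using bP(1) by (intro bij_imp_permutes) (simp_all cong: bij_betw_cong)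
  hence 1: "p1 \<in> edge_group r E e"
    by (rule edge_group_permutes[OF fin(1)]) (rule tr; use e(2) in blast)
  have "p2 permutes (e - P)" unfolding p2_def
    by (rule bij_imp_permutes, rule bij_betw_cong[THEN iffD1, OF _ bP(2)]) auto
  hence 2: "p2 \<in> edge_group r E e"
    by (rule edge_group_permutes[OF fin(2)]) (rule tr; blast)
  have "p = p1 \<circ> p2"
  proof
    fix x
    show "p x = (p1 \<circ> p2) x"
      using im(2) permutes_not_in[OF p(1), of x] e unfolding p1_def p2_def by auto
  qed
  thus ?thesis using edge_group_comp[OF 1 2] by simp
qed

text \<open>Ordering \<open>e\<close> so that membership of a position in \<open>P\<close> depends only on its residue modulo
  \<open>gcd r k\<close> makes the rotation by \<open>k\<close> preserve \<open>P\<close>.\<close>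

lemma rotate_block_reachable:
  assumes e: "finite e" "card e = r" "P \<subseteq> e" and r: "r > 0"
    and dv: "r div gcd r k dvd card P"
    and tr: "\<And>a b. a \<in> e \<Longrightarrow> b \<in> e \<Longrightarrow> a \<noteq> b \<Longrightarrow> (a \<in> P \<longleftrightarrow> b \<in> P) \<Longrightarrow> transpose a b \<in> edge_group r E e"
  shows "\<exists>xs. length xs = r \<and> set xs = e \<and> (xs, rotate k xs) \<in> (repl r E)\<^sup>*"
proof -
  define g where "g = gcd r k"
  define d where "d = r div g"
  have g: "g > 0" "g dvd r" "g dvd k" unfolding g_def using r by auto
  have rd: "r = g * d" unfolding d_def using g by simp
  obtain c where c: "card P = d * c" using dv unfolding d_def g_def by auto
  have "card P \<le> r" using e card_mono by blast
  hence "d * c \<le> d * g" using c rd by (simp add: mult.commute)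
  moreover have "d > 0" using rd r by (cases d) auto
  ultimately have cg: "c \<le> g" by simp
  \<comment> \<open>The positions whose residue modulo \<open>g\<close> is below \<open>c\<close>.
    There are \<open>d * c = card P\<close> of them, and shifting by \<open>k\<close> modulo
    \<open>r\<close> preserves them because \<open>g\<close> divides both \<open>r\<close> and
    \<open>k\<close>.\<close>
  define M where "M = {j. j < r \<and> j mod g < c}"
  have Mfin: "finite M" "M \<subseteq> {0..<r}" unfolding M_def by auto
  have "bij_betw (\<lambda>(i, j). i * g + j) ({0..<d} \<times> {0..<c}) M"
  proof (rule bij_betwI[where g = "\<lambda>x. (x div g, x mod g)"])
    show "(\<lambda>(i, j). i * g + j) \<in> {0..<d} \<times> {0..<c} \<rightarrow> M"
    proof clarsimp
      fix i j assume ij: "i < d" "j < c"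
      have "i * g + j < Suc i * g" using ij cg by simp
      also have "\<dots> \<le> d * g" using ij by (intro mult_le_mono1) auto
      finally show "i * g + j \<in> M" using ij cg rd unfolding M_def by (simp add: mult.commute)
    qed
    show "(\<lambda>x. (x div g, x mod g)) \<in> M \<rightarrow> {0..<d} \<times> {0..<c}"
      unfolding M_def using rd g by (auto simp: less_mult_imp_div_less mult.commute)
  qed (use cg g in auto)
  hence "card M = d * c" using bij_betw_same_card by fastforce
  hence cM: "card M = card P" using c by simp
  obtain h1 where h1: "bij_betw h1 M P"
    using finite_same_card_bij[OF Mfin(1) finite_subset[OF e(3,1)] cM] by blast
  have "card ({0..<r} - M) = card (e - P)"
    using cM Mfin e finite_subset[OF e(3,1)] by (simp add: card_Diff_subset)
  then obtain h2 where h2: "bij_betw h2 ({0..<r} - M) (e - P)"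
    using e finite_same_card_bij[of "{0..<r} - M" "e - P"] by auto
  define h where "h j = (if j \<in> M then h1 j else h2 j)" for j
  have hM: "bij_betw h M P" using h1 by (rule bij_betw_cong[THEN iffD1, rotated]) (simp add: h_def)
  have hN: "bij_betw h ({0..<r} - M) (e - P)"
    using h2 by (rule bij_betw_cong[THEN iffD1, rotated]) (simp add: h_def)
  have hb: "bij_betw h {0..<r} e"
    using bij_betw_combine[OF hM hN] Mfin e by (simp add: Un_absorb1)
  define xs where "xs = map h [0..<r]"
  have xs: "length xs = r" "set xs = e" "distinct xs"
    using hb unfolding xs_def bij_betw_def by (auto simp: distinct_map)
  have hP: "j < r \<Longrightarrow> h j \<in> P \<longleftrightarrow> j mod g < c" for j
  proof -
    assume j: "j < r"
    have "j \<in> M \<Longrightarrow> h j \<in> P" using hM unfolding bij_betw_def by blast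
    moreover have "j \<notin> M \<Longrightarrow> h j \<in> e - P" using hN j unfolding bij_betw_def
      by auto
    ultimately show ?thesis using j unfolding M_def by blast
  qed
  define hi where "hi = inv_into {0..<r} h"
  have hi: "a \<in> e \<Longrightarrow> hi a < r \<and> h (hi a) = a" for a
    using hb f_inv_into_f[of a h "{0..<r}"] inv_into_into[of a h "{0..<r}"]
    unfolding hi_def bij_betw_def by auto
  have hih: "j < r \<Longrightarrow> hi (h j) = j" for j
    using hb unfolding hi_def bij_betw_def by (simp add: inv_into_f_f)
  \<comment> \<open>The shift of positions by \<open>k\<close>, transported to \<open>e\<close>
    along the ordering \<open>h\<close>.\<close>
  define p where "p a = (if a \<in> e then h ((hi a + k) mod r) else a)" for a
  have pin: "a \<in> e \<Longrightarrow> p a \<in> e" for a unfolding p_def using hb r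
    unfolding bij_betw_def by auto
  have pmod: "(j + k) mod r mod g = j mod g" for j
    using g
    by (simp add: mod_mod_cancel mod_add_eq[of j g k, symmetric] dvd_imp_mod_0 del: mod_add_eq)
  have pP: "p a \<in> P \<longleftrightarrow> a \<in> P" if "a \<in> e" for a
    using hP[of "(hi a + k) mod r"] hP[of "hi a"] hi[OF that] r that pmod unfolding p_def by simp
  have mp: "map p xs = rotate k xs"
  proof (rule nth_equalityI)
    fix j assume "j < length (map p xs)"
    hence j: "j < r" using xs by simp
    have "h j \<in> e" using hb j unfolding bij_betw_def by auto
    thus "map p xs ! j = rotate k xs ! j"
      using j r unfolding xs_def by (simp add: nth_rotate p_def hih add.commute)
  qed (simp add: xs)
  have "inj_on p e"
  proof (rule eq_card_imp_inj_on)
    have "p ` set xs = set xs" using mp by (metis set_map set_rotate)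
    thus "card (p ` e) = card e" using xs by simp
  qed (rule e)
  hence "bij_betw p e e" using pin e by (simp add: bij_betw_def endo_inj_surj image_subsetI)
  hence "p permutes e" by (rule bij_imp_permutes) (simp add: p_def)
  hence "p \<in> edge_group r E e" using edge_group_block[OF e(1,3) tr] pP by blast
  hence "(xs, map p xs) \<in> (repl r E)\<^sup>*" using xs unfolding edge_group_def by auto
  thus ?thesis using xs mp by auto
qed

subsection \<open>Colourings with two blocks\<close>

text \<open>In every edge the relation \<open>red (e - {a, b})\<close> between vertices \<open>a\<close>, \<open>b\<close> is an equivalence
  relation with at most two classes; the assumption \<open>odd_red\<close> is equivalent to this.\<close>

locale two_block_colouring =
  fixes V :: "'a set" and E :: "'a set set" and r :: nat and red :: "'a set \<Rightarrow> bool"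
  assumes finV: "finite V"
    and E_sub: "\<And>e. e \<in> E \<Longrightarrow> e \<subseteq> V"
    and E_card: "\<And>e. e \<in> E \<Longrightarrow> card e = r"
    and r3: "r \<ge> 3" and rV: "r \<le> card V"
    and codeg: "\<And>S. S \<subseteq> V \<Longrightarrow> card S = r - 1 \<Longrightarrow> card V < 3 * card (nbrs E S)"
    and odd_red: "\<And>a b c W. insert a (insert b (insert c W)) \<in> E \<Longrightarrow> distinct [a, b, c] \<Longrightarrow>
      a \<notin> W \<Longrightarrow> b \<notin> W \<Longrightarrow> c \<notin> W \<Longrightarrow>
      red (insert c W) \<longleftrightarrow> (red (insert a W) \<longleftrightarrow> red (insert b W))"
begin

definition big :: "'a set \<Rightarrow> bool" where "big D \<longleftrightarrow> D \<subseteq> V \<and> card V < 3 * card D"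

lemma big_disjoint3:
  assumes "big A" "big B" "big C" "A \<inter> B = {}" "A \<inter> C = {}" "B \<inter> C = {}"
  shows False
proof -
  have f: "finite A" "finite B" "finite C" using assms finV finite_subset unfolding big_def
    by blast+
  have "card (A \<union> B \<union> C) = card A + card B + card C"
    using f assms by (simp add: card_Un_disjoint Int_Un_distrib2)
  moreover have "card (A \<union> B \<union> C) \<le> card V"
    using assms finV unfolding big_def by (intro card_mono) auto
  ultimately show False using assms unfolding big_def by linarith
qed

lemma big_nbrs: "S \<subseteq> V \<Longrightarrow> card S = r - 1 \<Longrightarrow> big (nbrs E S)"
  unfolding big_def using codeg E_sub by (auto simp: nbrs_def)

lemma big_nonempty: "big D \<Longrightarrow> \<exists>x. x \<in> D"
  unfolding big_def by (metis card.empty equals0I mult_0_right not_less_zero)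

text \<open>From \<open>card V \<ge> r \<ge> 3\<close> a big set has at least two elements, so a
  completing vertex different from a known one can always be chosen.\<close>

lemma big_other: "big D \<Longrightarrow> \<exists>x\<in>D. x \<noteq> y"
proof (rule ccontr)
  assume D: "big D" "\<not> (\<exists>x\<in>D. x \<noteq> y)"
  hence "D \<subseteq> {y}" by auto
  hence "card D \<le> 1"
    by (metis card_mono finite.intros(1) finite_insert is_singletonI is_singleton_altdef)
  thus False using D rV r3 unfolding big_def by linarith
qed

text \<open>The last configuration to be excluded in the descent of blocks. For fixed
  \<open>Z\<close>, \<open>cc\<close> below is a graph on the other vertices in which
  \<open>q\<close> is joined to everything. Nonadjacency turns out to be transitive, and combined
  with the link of \<open>insert q (insert v Z)\<close> this produces three disjoint big
  sets.\<close>

lemma no_full_red: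
  assumes Z: "Z \<subseteq> V" "card Z + 4 = r"
    and q: "q \<in> V" "q \<notin> Z"
    and mono: "\<And>u. u \<in> V \<Longrightarrow> u \<notin> Z \<Longrightarrow> u \<noteq> q \<Longrightarrow> red (insert q (insert u Z))"
    and p: "p \<in> V" "p \<notin> Z" "p \<noteq> q"
    and x: "x \<in> V" "x \<notin> Z" "x \<noteq> q" "x \<noteq> p"
    and v: "v \<in> V" "v \<notin> Z" "v \<noteq> q" "v \<noteq> p"
    and w: "w \<in> V" "w \<notin> Z" "w \<noteq> q" "w \<noteq> p" "w \<noteq> v"
    and px: "\<not> red (insert p (insert x Z))" and pv: "red (insert p (insert v Z))"
    and z: "z \<in> Z" and zw: "\<not> red (insert w (insert q (insert v (Z - {z}))))"
    and zp: "\<not> red (insert p (insert q (insert v (Z - {z}))))"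
  shows False
proof -
  define cc where "cc u u' \<longleftrightarrow> red (insert u (insert u' Z))" for u u'
  define N where "N a b c = nbrs E (insert a (insert b (insert c Z)))" for a b c
  have cs: "cc u u' = cc u' u" for u u' unfolding cc_def by (simp add: insert_commute)
  have finZ: "finite Z" using Z finV finite_subset by blast
  have qr: "cc q u" if "u \<in> V" "u \<notin> Z" "u \<noteq> q" for u using mono that
    unfolding cc_def by blast
  have bN: "big (N a b c)"
    if "a \<in> V" "b \<in> V" "c \<in> V" "a \<notin> Z" "b \<notin> Z" "c \<notin> Z" "distinct [a,b,c]" for a b c
    unfolding N_def using that Z finZ by (intro big_nbrs) auto
  have Nin: "g \<in> V \<and> g \<notin> Z \<and> g \<noteq> a \<and> g \<noteq> b \<and> g \<noteq> c" if "g \<in> N a b c" for g a b c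
    using that E_sub unfolding N_def nbrs_def by blast
  \<comment> \<open>Parity rule: if \<open>a\<close>, \<open>b\<close>, \<open>c\<close>,
    \<open>g\<close> complete \<open>Z\<close> to an edge, then \<open>a\<close> is joined in
    \<open>cc\<close> to an odd number of \<open>b\<close>, \<open>c\<close>,
    \<open>g\<close>.\<close>
  have Nr: "cc a g \<longleftrightarrow> (cc a b \<longleftrightarrow> cc a c)"
    if "g \<in> N a b c" "a \<notin> Z" "b \<notin> Z" "c \<notin> Z" "distinct [a,b,c]" for a b c g
  proof -
    have "insert b (insert c (insert g (insert a Z))) \<in> E"
      using that(1) unfolding N_def nbrs_def by (simp add: insert_commute)
    from odd_red[OF this] Nin[OF that(1)] that
    have "red (insert g (insert a Z)) \<longleftrightarrow> (red (insert b (insert a Z)) \<longleftrightarrow> red (insert c (insert a Z)))"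
      by fastforce
    thus ?thesis unfolding cc_def by (simp add: insert_commute)
  qed
  have N1: "N a b c = N b a c" and N2: "N a b c = N a c b" for a b c
    unfolding N_def by (simp_all add: insert_commute)
  have Nrb: "cc b g \<longleftrightarrow> (cc a b \<longleftrightarrow> cc b c)"
    if "g \<in> N a b c" "a \<notin> Z" "b \<notin> Z" "c \<notin> Z" "distinct [a,b,c]" for a b c g
    using Nr[of g b a c] that N1[of a b c] cs by auto
  \<comment> \<open>Nonadjacency is transitive. Otherwise the neighbourhoods \<open>N a b q\<close>,
    \<open>N a b f\<close>, \<open>N a b g0\<close> show three different patterns of adjacency to
    \<open>a\<close> and \<open>b\<close>, so they are disjoint.\<close>
  have region: False
    if ab: "\<not> cc a b" and fa: "cc f a" and fb: "\<not> cc f b"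
      and inV: "a \<in> V" "b \<in> V" "f \<in> V" "a \<notin> Z" "b \<notin> Z" "f \<notin> Z" "a \<noteq> b" "f \<noteq> a" "f \<noteq> b" for a b f
  proof -
    have nq: "a \<noteq> q" "b \<noteq> q" "f \<noteq> q" using ab fb qr inV cs by metis+
    have b1: "big (N a b q)" and b2: "big (N a b f)" using inV nq q by (auto intro!: bN)
    have qa: "cc a q" "cc b q" using qr inV nq cs by blast+
    have c1: "\<not> cc a g \<and> \<not> cc b g" if "g \<in> N a b q" for g
      using Nr[OF that] Nrb[OF that] inV nq q qa ab by auto
    have c2: "\<not> cc a g \<and> cc b g" if "g \<in> N a b f" for g
      using Nr[OF that] Nrb[OF that] inV ab fa fb cs by auto
    obtain g0 where g0: "g0 \<in> N a b f" using big_nonempty[OF b2] by blast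
    have g0V: "g0 \<in> V" "g0 \<notin> Z" "g0 \<noteq> a" "g0 \<noteq> b" using Nin[OF g0] by auto
    have b3: "big (N a b g0)" using inV g0V by (auto intro!: bN)
    have c3: "cc a g \<and> \<not> cc b g" if "g \<in> N a b g0" for g
      using Nr[OF that] Nrb[OF that] inV ab c2[OF g0] g0V by auto
    show False by (rule big_disjoint3[OF b1 b2 b3]) (use c1 c2 c3 in blast)+
  qed
  define K where "K = N p q x"
  have bK: "big K" unfolding K_def using p q x by (auto intro!: bN)
  have pq: "cc p q" using qr p cs by blast
  have Kp: "\<not> cc p k \<and> k \<in> V \<and> k \<notin> Z \<and> k \<noteq> p \<and> k \<noteq> q" if "k \<in> K" for k
    using Nr[of k p q x] Nin[of k p q x] that p q x px pq unfolding K_def cc_def[of p x] by auto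
  have pv': "cc p v" using pv unfolding cc_def .
  \<comment> \<open>\<open>p\<close> and \<open>k\<close> are nonadjacent, so by
    \<open>region\<close> they have the same neighbours. Thus \<open>k\<close> is joined to
    \<open>v\<close>, the parity rule joins it to \<open>g\<close>, and then \<open>p\<close> is
    joined to \<open>g\<close> as well.\<close>
  have KN: "cc p g" if k: "k \<in> K" and g: "g \<in> N q v k" for k g
  proof (rule ccontr)
    assume pg: "\<not> cc p g"
    have kk: "\<not> cc p k" "k \<in> V" "k \<notin> Z" "k \<noteq> p" "k \<noteq> q" using Kp[OF k]
      by auto
    have kv: "k \<noteq> v" using kk pv' by auto
    have gg: "g \<in> V" "g \<notin> Z" "g \<noteq> q" "g \<noteq> v" "g \<noteq> k" using Nin[OF g]
      by auto
    have gp: "g \<noteq> p"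
    proof
      assume gp: "g = p"
      hence "k \<in> N p q v" using g kk kv p unfolding N_def nbrs_def
        by (auto simp: insert_commute)
      from Nr[OF this] kk pv' pq p q v show False by auto
    qed
    show False
    proof (cases "cc k v")
      case False
      show False using region[of p k v] kk kv pv' False v p cs by blast
    next
      case True
      have gN: "g \<in> N k q v" using g N1 N2 by metis
      have "cc k g \<longleftrightarrow> (cc k q \<longleftrightarrow> cc k v)"
        using Nr[OF gN] kk q v kv by auto
      hence "cc k g" using True qr kk cs by blast
      thus False using region[of g p k] kk gg gp p pg cs by blast
    qed
  qed
  define Y where "Y = insert q (insert v (Z - {z}))"
  define X where "X = {u. red (insert u Y)}"
  have T: "insert z Y = insert q (insert v Z)" unfolding Y_def using z by auto
  have zY: "z \<notin> Y" unfolding Y_def using z q v by auto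
  have YV: "Y \<subseteq> V" "finite Y" unfolding Y_def using Z q v finZ by auto
  have "card (insert z Y) = card Z + 2" unfolding T using Z finZ q v by simp
  hence cY: "card Y + 3 = r" using zY YV Z by simp
  have zX: "z \<in> X" using qr[of v] v T unfolding X_def cc_def by simp
  have wX: "w \<notin> X" "p \<notin> X" using zw zp unfolding X_def Y_def by auto
  have wpY: "w \<notin> Y" "p \<notin> Y" unfolding Y_def using w p v by auto
  \<comment> \<open>As \<open>insert z Y\<close> is red, membership in \<open>X\<close> does not
    change along an edge of its link graph.\<close>
  have adj: "u' \<in> X \<longleftrightarrow> u \<in> X"
    if "u' \<in> N q v u" "u \<notin> insert z Y" for u u'
  proof -
    have "insert z (insert u (insert u' Y)) \<in> E" "u' \<notin> insert z Y" "u' \<noteq> u"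
      using that(1) T unfolding N_def nbrs_def by (auto simp: insert_commute)
    from odd_red[OF this(1)] this(2,3) that zY zX show ?thesis unfolding X_def by auto
  qed
  \<comment> \<open>\<open>p\<close> and \<open>w\<close> lie outside \<open>X\<close>, so a vertex
    completing them and \<open>Y\<close> to an edge lies in \<open>X\<close>. Choosing it different
    from \<open>z\<close> keeps it outside \<open>insert z Y\<close>, where \<open>adj\<close>
    applies.\<close>
  have "big (nbrs E (insert p (insert w Y)))"
    using YV cY wpY w p by (intro big_nbrs) auto
  then obtain v' where v': "v' \<in> nbrs E (insert p (insert w Y))" "v' \<noteq> z"
    using big_other by blast
  have v'n: "v' \<notin> Y" "v' \<noteq> p" "v' \<noteq> w" "insert p (insert w (insert v' Y)) \<in> E"
    using v'(1) unfolding nbrs_def by (auto simp: insert_commute)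
  have v'X: "v' \<in> X" using odd_red[OF v'n(4)] v'n wpY wX w unfolding X_def by auto
  have v'V: "v' \<in> V" "v' \<notin> Z" "v' \<noteq> q" "v' \<noteq> v"
    using E_sub[OF v'n(4)] v'n(1) v'(2) unfolding Y_def by auto
  have pT: "p \<notin> insert z Y" using wpY z p by auto
  have bp: "big (N q v p)" using q v p by (auto intro!: bN)
  have pI: "cc p g \<and> g \<notin> X" if "g \<in> N q v p" for g
  proof -
    have "g \<in> N p q v" using that N1 N2 by metis
    thus ?thesis using Nr[of g p q v] p q v pq pv' adj[OF that pT] wX by auto
  qed
  have pd: "N q v p \<inter> K = {}" using pI Kp by blast
  \<comment> \<open>The three disjoint sets are \<open>K\<close>, \<open>N q v p\<close> and the
    neighbourhood over \<open>{q, v}\<close> and \<open>Z\<close> of a vertex of \<open>X\<close>.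
    This vertex is \<open>v'\<close> if \<open>K\<close> misses \<open>X\<close>, and otherwise an
    element of \<open>K \<inter> X\<close>.\<close>
  show False
  proof (cases "K \<inter> X = {}")
    case True
    have b: "big (N q v v')" using q v v'V by (auto intro!: bN)
    have "N q v v' \<subseteq> X" using adj[of _ v'] v'n v'(2) v'X by blast
    thus False using big_disjoint3[OF bK bp b] True pd pI by blast
  next
    case False
    then obtain k where k: "k \<in> K" "k \<in> X" by blast
    have kk: "\<not> cc p k" "k \<in> V" "k \<notin> Z" "k \<noteq> p" "k \<noteq> q" "k \<noteq> v"
      using Kp[OF k(1)] pv' by auto
    have b: "big (N q v k)" using q v kk by (auto intro!: bN)
    have "k \<notin> insert z Y" using kk z unfolding Y_def by auto
    hence "N q v k \<subseteq> X" using adj[of _ k] k by blast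
    moreover have "N q v k \<inter> K = {}" using KN[OF k(1)] Kp by blast
    ultimately show False using big_disjoint3[OF bK bp b] pd pI by blast
  qed
qed

section \<open>Blocks of an edge and their descent by two\<close>

definition block :: "'a set \<Rightarrow> 'a set \<Rightarrow> bool" where
  "block e P \<longleftrightarrow> e \<in> E \<and> P \<subseteq> e \<and>
     (\<forall>a\<in>e. \<forall>b\<in>e. a \<noteq> b \<longrightarrow> (red (e - {a, b}) \<longleftrightarrow> (a \<in> P \<longleftrightarrow> b \<in> P)))"

lemma odd_red_edge:
  assumes e: "e \<in> E" "a \<in> e" "b \<in> e" "c \<in> e" "distinct [a, b, c]"
  shows "red (e - {a, b}) \<longleftrightarrow> (red (e - {a, c}) \<longleftrightarrow> red (e - {b, c}))"
proof -
  define W where "W = e - {a, b, c}"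
  have s: "e - {a, b} = insert c W" "e - {a, c} = insert b W" "e - {b, c} = insert a W"
    "e = insert a (insert b (insert c W))"
    unfolding W_def using e by auto
  have "insert a (insert b (insert c W)) \<in> E" using e s(4) by simp
  from odd_red[OF this e(5)] show ?thesis unfolding s(1-3) by (auto simp: W_def)
qed

text \<open>By \<open>odd_red\<close> being in different classes than \<open>w\<close> singles out
  one of at most two classes, namely the one without \<open>w\<close>; it may be empty.\<close>

lemma block_of_vertex:
  assumes e: "e \<in> E" "w \<in> e"
  shows "block e {a \<in> e. a \<noteq> w \<and> \<not> red (e - {a, w})}"
  unfolding block_def
proof (intro conjI ballI impI)
  fix a b assume ab: "a \<in> e" "b \<in> e" "a \<noteq> b"
  show "red (e - {a, b}) \<longleftrightarrow>
    (a \<in> {a \<in> e. a \<noteq> w \<and> \<not> red (e - {a, w})} \<longleftrightarrow> b \<in> {a \<in> e. a \<noteq> w \<and> \<not> red (e - {a, w})})"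
    using odd_red_edge[of e a b w] e ab
    by (cases "a = w"; cases "b = w") (auto simp: insert_commute)
qed (use e in auto)

text \<open>Keep \<open>T = e - {x, x'}\<close> with \<open>x\<close>, \<open>x'\<close> in
  \<open>P\<close> and complete it by an edge \<open>{v, w}\<close> from another component of its
  link graph. The vertices of \<open>T\<close> outside \<open>P\<close> join the block of
  \<open>v\<close> and \<open>w\<close>, those inside \<open>P\<close> form the opposite block, so
  exactly \<open>x\<close> and \<open>x'\<close> are lost.\<close>

lemma block_descent:
  assumes noempty: "\<And>e. \<not> block e {}" "\<And>e. \<not> block e e"
    and B: "block e P" "card P \<ge> 2"
  shows "\<exists>e' P'. block e' P' \<and> card P' = card P - 2"
proof -
  have e: "e \<in> E" "P \<subseteq> e"
    and rel: "\<And>a b. a \<in> e \<Longrightarrow> b \<in> e \<Longrightarrow> a \<noteq> b \<Longrightarrow> red (e - {a, b}) \<longleftrightarrow> (a \<in> P \<longleftrightarrow> b \<in> P)"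
    using B unfolding block_def by auto
  have eV: "e \<subseteq> V" "card e = r" "finite e" using e E_sub E_card finV finite_subset
    by blast+
  have finP: "finite P" using e eV finite_subset by blast
  obtain x where x: "x \<in> P" using B(2) by fastforce
  have "card (P - {x}) \<ge> 1" using B(2) x finP by simp
  then obtain x' where x': "x' \<in> P" "x' \<noteq> x"
    by (metis Diff_iff card.empty equals0I insertI1 not_one_le_zero)
  have "P \<noteq> e" using noempty B by blast
  then obtain q0 where q0: "q0 \<in> e" "q0 \<notin> P" using e by blast
  define T where "T = e - {x, x'}"
  have xe: "x \<in> e" "x' \<in> e" using x x' e by auto
  have Te: "e = insert x (insert x' T)" "x \<notin> T" "x' \<notin> T" "T \<subseteq> V" "finite T"
    unfolding T_def using xe eV by auto
  have cT: "card T + 2 = r" using Te x' eV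
    by (metis Suc_1 add_2_eq_Suc' card_insert_disjoint finite_insert insert_iff)
  have redT: "red T" unfolding T_def using rel xe x x' by auto
  \<comment> \<open>\<open>\<kappa> u\<close> is constant on the components of the link graph of \<open>T\<close>, of which there are at most two.\<close>
  define \<kappa> where "\<kappa> u t \<longleftrightarrow> red (insert u (T - {t}))" for u t
  define N where "N u = nbrs E (insert u T)" for u
  have bN: "big (N u)" if "u \<in> V" "u \<notin> T" for u
    unfolding N_def using that Te cT by (intro big_nbrs) auto
  have Nin: "u' \<in> V \<and> u' \<notin> T \<and> u' \<noteq> u \<and> insert u' (insert u T) \<in> E" if "u' \<in> N u" for u u'
    using that E_sub unfolding N_def nbrs_def by blast
  have adj: "\<kappa> u' t \<longleftrightarrow> \<kappa> u t"
    if "u' \<in> N u" "u \<notin> T" "t \<in> T" for u u' t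
  proof -
    have i: "insert t (T - {t}) = T" using that by auto
    have "insert t (insert u (insert u' (T - {t}))) = insert u' (insert u T)"
      using that by auto
    hence E: "insert t (insert u (insert u' (T - {t}))) \<in> E" using Nin[OF that(1)] by simp
    have "red (insert u' (T - {t})) \<longleftrightarrow> (red (insert t (T - {t})) \<longleftrightarrow> red (insert u (T - {t})))"
      by (rule odd_red[OF E]) (use Nin[OF that(1)] that in auto)
    thus ?thesis using redT i unfolding \<kappa>_def by simp
  qed
  \<comment> \<open>Three pairwise different patterns \<open>\<kappa> u\<close> would give three
    disjoint neighbourhoods in the link of \<open>T\<close>.\<close>
  have three: False
    if "u1 \<in> V - T" "u2 \<in> V - T" "u3 \<in> V - T" "s1 \<in> T" "s2 \<in> T" "s3 \<in> T"
    "\<kappa> u1 s1 \<noteq> \<kappa> u2 s1" "\<kappa> u1 s2 \<noteq> \<kappa> u3 s2" "\<kappa> u2 s3 \<noteq> \<kappa> u3 s3" for u1 u2 u3 s1 s2 s3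
  proof (rule big_disjoint3[OF bN bN bN])
    show "N u1 \<inter> N u2 = {}" "N u1 \<inter> N u3 = {}" "N u2 \<inter> N u3 = {}"
      using adj that by blast+
  qed (use that in auto)
  have xV: "x \<in> V - T" "x' \<in> V - T" using xe eV Te by auto
  have \<kappa>x: "\<kappa> x t \<longleftrightarrow> t \<in> P" "\<kappa> x' t \<longleftrightarrow> t \<in> P" if "t \<in> T" for t
  proof -
    have te: "t \<in> e" "t \<noteq> x" "t \<noteq> x'" using that unfolding T_def by auto
    have "insert x (T - {t}) = e - {t, x'}" "insert x' (T - {t}) = e - {t, x}"
      using Te te x' by auto
    thus "\<kappa> x t \<longleftrightarrow> t \<in> P" "\<kappa> x' t \<longleftrightarrow> t \<in> P" unfolding \<kappa>_def using rel te xe x x' by auto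
  qed
  \<comment> \<open>\<open>\<kappa> x q\<close> and \<open>\<kappa> x' q\<close> both fail, so any
    vertex \<open>v\<close> completing \<open>x\<close>, \<open>x'\<close> and
    \<open>T - {q}\<close> to an edge satisfies \<open>\<kappa> v q\<close>. The choice
    \<open>v = q\<close> would only return \<open>e\<close>.\<close>
  have ex_red: "\<exists>v\<in>V - T. \<kappa> v q" if "q \<in> T" "q \<notin> P" for q
  proof -
    let ?S = "insert x (insert x' (T - {q}))"
    have "insert q ?S = e" "q \<notin> ?S" using Te that by auto
    hence "card ?S = r - 1" using eV Te
      by (metis card_insert_disjoint diff_Suc_1 finite_Diff finite_insert)
    hence "big (nbrs E ?S)" using Te xV by (intro big_nbrs) auto
    then obtain v where v: "v \<in> nbrs E ?S" "v \<noteq> q" using big_other by blast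
    have vE: "insert x (insert x' (insert v (T - {q}))) \<in> E" "v \<notin> T" "v \<noteq> x" "v \<noteq> x'"
      using v unfolding nbrs_def by (auto simp: insert_commute)
    have "red (insert v (T - {q})) \<longleftrightarrow> (red (insert x (T - {q})) \<longleftrightarrow> red (insert x' (T - {q})))"
      by (rule odd_red[OF vE(1)]) (use vE x' Te in auto)
    hence "\<kappa> v q" using \<kappa>x[OF that(1)] that unfolding \<kappa>_def by simp
    thus ?thesis using vE E_sub by blast
  qed
  have q0T: "q0 \<in> T" using q0 x x' unfolding T_def by auto
  obtain v where v: "v \<in> V - T" "\<kappa> v q0" using ex_red[OF q0T q0(2)] by blast
  have xq0: "\<not> \<kappa> x q0" using \<kappa>x[OF q0T] q0 by simp
  obtain w where w: "w \<in> N v" using big_nonempty[OF bN] v by blast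
  have ww: "w \<in> V" "w \<notin> T" "w \<noteq> v" "insert w (insert v T) \<in> E" using Nin[OF w]
    by auto
  define e2 where "e2 = insert w (insert v T)"
  define P' where "P' = {a \<in> e2. a \<noteq> w \<and> \<not> red (e2 - {a, w})}"
  have bl: "block e2 P'" unfolding P'_def
    by (rule block_of_vertex) (use ww in \<open>auto simp: e2_def\<close>)
  have P'eq: "P' = {t \<in> T. \<not> \<kappa> v t}"
  proof -
    have "e2 - {v, w} = T" unfolding e2_def using v ww by auto
    moreover have "e2 - {t, w} = insert v (T - {t})" if "t \<in> T" for t
      unfolding e2_def using v ww that by auto
    ultimately show ?thesis using v ww redT unfolding P'_def \<kappa>_def e2_def by auto
  qed
  \<comment> \<open>If \<open>\<kappa> v q\<close> failed, a vertex \<open>u\<close> with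
    \<open>\<kappa> u q\<close> would have a third pattern besides those of \<open>x\<close> and
    \<open>v\<close>, which already differ at \<open>q0\<close>.\<close>
  have vQ: "\<kappa> v q" if that': "q \<in> T" "q \<notin> P" for q
  proof (rule ccontr)
    assume n: "\<not> \<kappa> v q"
    obtain u where u: "u \<in> V - T" "\<kappa> u q" using ex_red[OF that'] by blast
    have "\<not> \<kappa> x q" using \<kappa>x[OF that(1)] that by simp
    thus False using three[OF xV(1) v(1) u(1) q0T that(1) that(1)] xq0 v u n by blast
  qed
  \<comment> \<open>If \<open>\<kappa> v p\<close> held, the two patterns would agree at
    \<open>p\<close>, so \<open>\<kappa> u p\<close> would hold for every \<open>u\<close>. With
    \<open>q0\<close> as the vertex joined to all others this is what \<open>no_full_red\<close>
    excludes; its \<open>z\<close> comes from \<open>P'\<close> being nonempty.\<close>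
  have vP: "\<not> \<kappa> v p" if "p \<in> T" "p \<in> P" for p
  proof
    assume n: "\<kappa> v p"
    have all: "\<kappa> u p" if "u \<in> V - T" for u
    proof (rule ccontr)
      assume "\<not> \<kappa> u p"
      moreover have "\<kappa> x p"
        using \<kappa>x[OF \<open>p \<in> T\<close>] \<open>p \<in> P\<close> by simp
      ultimately show False
        using three[OF xV(1) v(1) \<open>u \<in> V - T\<close> q0T \<open>p \<in> T\<close> \<open>p \<in> T\<close>] xq0 v n by blast
    qed
    have pq: "p \<noteq> q0" using that q0 by auto
    define Z where "Z = T - {p, q0}"
    have TZ: "T = insert p (insert q0 Z)" "p \<notin> Z" "q0 \<notin> Z" unfolding Z_def
      using that q0T by auto
    have TZ': "T - {p} = insert q0 Z" "T - {q0} = insert p Z" using TZ pq by auto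
    have ZV: "Z \<subseteq> V" "finite Z" "card Z + 4 = r" using Te cT TZ pq by auto
    have "P' \<noteq> {}" using bl noempty by metis
    then obtain z where z: "z \<in> T" "\<not> \<kappa> v z" unfolding P'eq by blast
    have zZ: "z \<in> Z" using z n v unfolding Z_def by auto
    have e2E: "e2 \<in> E" using ww unfolding e2_def by simp
    have zw: "z \<in> P'" using z P'eq by simp
    have brel: "red (e2 - {a, b}) \<longleftrightarrow> (a \<in> P' \<longleftrightarrow> b \<in> P')" if "a \<in> e2" "b \<in> e2" "a \<noteq> b" for a b
      using bl that unfolding block_def by blast
    have nP: "p \<notin> P'" "w \<notin> P'" using n ww unfolding P'eq by auto
    have inn: "p \<in> e2" "w \<in> e2" "z \<in> e2" "p \<noteq> z" "w \<noteq> z" using that ww z n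
      unfolding e2_def by auto
    have r1: "\<not> red (e2 - {z, p})" "\<not> red (e2 - {z, w})" using brel inn nP zw by auto
    have s1: "e2 - {z, p} = insert w (insert q0 (insert v (Z - {z})))"
      "e2 - {z, w} = insert p (insert q0 (insert v (Z - {z})))"
      unfolding e2_def TZ(1) using zZ TZ v ww pq that q0T by auto
    show False
    proof (rule no_full_red[OF ZV(1,3), of q0 p x v w z])
      show "red (insert q0 (insert u Z))" if "u \<in> V" "u \<notin> Z" "u \<noteq> q0" for u
      proof (cases "u = p")
        case True thus ?thesis using redT TZ by (simp add: insert_commute)
      next
        case False
        hence "u \<in> V - T" using that TZ by auto
        from all[OF this] show ?thesis unfolding \<kappa>_def TZ' by (simp add: insert_commute)
      qed
      show "\<not> red (insert p (insert x Z))" using xq0 unfolding \<kappa>_def TZ'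
        by (simp add: insert_commute)
      show "red (insert p (insert v Z))" using v(2) unfolding \<kappa>_def TZ'
        by (simp add: insert_commute)
    qed (use r1 s1 zZ TZ v ww pq xV that q0T Te in auto)
  qed
  have "P' = P - {x, x'}" unfolding P'eq using vP vQ e unfolding T_def by blast
  hence "card P' = card P - 2" using x x' finP by (simp add: card_Diff_subset)
  thus ?thesis using bl by blast
qed

text \<open>Otherwise the descent is always possible. An even block would descend to size
  \<open>0\<close>, and an odd one of size at least \<open>d\<close> to size \<open>d\<close>, so
  all blocks are odd and smaller than \<open>d\<close>. A block and its complement then make
  \<open>r\<close> even, hence at least \<open>2 * d\<close>, although their sizes add up to less
  than \<open>2 * d\<close>.\<close>

lemma block_divisible:
  assumes d: "odd d" "d dvd r"
  shows "\<exists>e P. block e P \<and> d dvd card P"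
proof (rule ccontr)
  assume no: "\<not> ?thesis"
  have ne: "\<not> block e {}" "\<not> block e e" for e
    using no d E_card unfolding block_def by fastforce+
  have desc: "\<exists>e' P'. block e' P' \<and> card P' = s" if "block e P" "card P = s + 2 * j"
    for e P s j
    using that
  proof (induction j arbitrary: e P)
    case (Suc j)
    from block_descent[OF ne Suc.prems(1)] Suc.prems(2) obtain e' P' where
      "block e' P'" "card P' = s + 2 * j" by auto
    thus ?case using Suc.IH by blast
  qed auto
  obtain S where S: "S \<subseteq> V" "card S = r - 1" using rV
    by (metis diff_le_self le_trans obtain_subset_with_card_n)
  obtain v where "v \<in> nbrs E S" using big_nonempty[OF big_nbrs[OF S]] by blast
  hence e: "insert v S \<in> E" "v \<in> insert v S" unfolding nbrs_def by auto
  define e where "e = insert v S"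
  obtain P where P: "block e P" using block_of_vertex[OF e] unfolding e_def by blast
  have Q: "block e (e - P)" using P unfolding block_def by auto
  have eE: "e \<in> E" "P \<subseteq> e" using P unfolding block_def by auto
  have fe: "finite e" "card e = r" "P \<subseteq> e"
    using eE E_card finite_subset[OF E_sub finV] by auto
  have cPQ: "card P + card (e - P) = r" using fe
    by (metis card_Diff_subset card_mono finite_subset le_add_diff_inverse)
  have ev: "odd (card P')" if "block e' P'" for e' P'
  proof
    assume "even (card P')"
    then obtain j where "card P' = 0 + 2 * j" by auto
    from desc[OF that this] no show False by (metis dvd_0_right)
  qed
  have lt: "card P' < d" if "block e' P'" for e' P'
  proof (rule ccontr)
    assume "\<not> card P' < d"
    moreover have "even (card P' - d)" using ev[OF that] d calculation by simp
    ultimately obtain j where "card P' = d + 2 * j" by (metis dvd_def le_add_diff_inverse not_less)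
    from desc[OF that this] no show False by (metis dvd_refl)
  qed
  obtain c where c: "r = d * c" using d by auto
  have "even r" using ev[OF P] ev[OF Q] cPQ by (metis odd_add)
  hence "even c" "c \<noteq> 0" using c d r3 by (auto intro!: Nat.gr0I)
  hence "c \<ge> 2" by presburger
  hence "2 * d \<le> r" using c by simp
  thus False using lt[OF P] lt[OF Q] cPQ by linarith
qed

end

subsection \<open>Links of codegree above one third\<close>

text \<open>Exchanging two positions turns a replacement at \<open>l\<close> into one at
  \<open>transpose i j l\<close>, so a whole chain of replacements can be carried along.\<close>

lemma repl_swap_positions:
  assumes "(xs, ys) \<in> (repl r E)\<^sup>*" "i < r" "j < r"
  shows "(xs[i := xs ! j, j := xs ! i], ys[i := ys ! j, j := ys ! i]) \<in> (repl r E)\<^sup>*"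
  using assms(1)
proof (induction rule: rtrancl_induct)
  case (step ys zs)
  have yz: "length ys = r" "length zs = r" "set ys \<in> E" "set zs \<in> E" using step(2)
    unfolding repl_def by auto
  obtain l where l: "l < r" "\<And>i. i < r \<Longrightarrow> i \<noteq> l \<Longrightarrow> ys ! i = zs ! i" using step(2) unfolding repl_def by auto
  let ?t = "transpose i j"
  have tr: "xs[i := xs ! j, j := xs ! i] ! m = xs ! ?t m" if "length xs = r" "m < r"
    for xs :: "'a list" and m
    using that assms by (auto simp: nth_list_update transpose_def)
  have st: "set (xs[i := xs ! j, j := xs ! i]) = set xs" if "length xs = r" for xs :: "'a list"
    using that assms by (simp add: set_swap)
  have "(ys[i := ys ! j, j := ys ! i], zs[i := zs ! j, j := zs ! i]) \<in> repl r E"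
  proof (rule repl_nth[where j = "?t l"])
    show "?t l < r" using l assms by (auto simp: transpose_def)
    fix m assume m: "m < r" "m \<noteq> ?t l"
    have "?t m < r" "?t m \<noteq> l" using m assms by (auto simp: transpose_def split: if_splits)
    thus "ys[i := ys ! j, j := ys ! i] ! m = zs[i := zs ! j, j := zs ! i] ! m"
      using tr yz m l by simp
  qed (use yz st in auto)
  with step show ?case by simp
qed simp

text \<open>\<open>U\<close> is one side of a proper 2-colouring of the link graph of
  \<open>T\<close>; in use, \<open>T\<close> has \<open>r - 2\<close> elements.\<close>

definition link_bipartite :: "'a set set \<Rightarrow> 'a set \<Rightarrow> bool" where
  "link_bipartite E T \<longleftrightarrow> (\<exists>U. \<forall>u v. u \<notin> T \<longrightarrow> v \<notin> T \<longrightarrow> u \<noteq> v \<longrightarrow> insert u (insert v T) \<in> E \<longrightarrow> (u \<in> U \<longleftrightarrow> v \<notin> U))"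

locale codegree_third =
  fixes V :: "'a set" and E :: "'a set set" and r :: nat
  assumes finV: "finite V"
    and E_sub: "\<And>e. e \<in> E \<Longrightarrow> e \<subseteq> V"
    and E_card: "\<And>e. e \<in> E \<Longrightarrow> card e = r"
    and r2: "r \<ge> 2"
    and codeg: "\<And>S. S \<subseteq> V \<Longrightarrow> card S = r - 1 \<Longrightarrow> card V < 3 * card (nbrs E S)"
begin

text \<open>Fixing all coordinates of an ordering of \<open>e\<close> except those of \<open>a\<close> and \<open>b\<close>, the pairs that can be
  reached from \<open>(a, b)\<close> sweep out a component of the link graph of \<open>e - {a, b}\<close>. If \<open>(b, a)\<close> is not
  reached, this component is bipartite, hence it has more than two thirds of the vertices, and no
  room is left for a second component.\<close>

lemma transpose_in_edge_group:
  assumes e: "e \<in> E" "a \<in> e" "b \<in> e" "a \<noteq> b"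
    and nb: "\<not> link_bipartite E (e - {a, b})"
  shows "transpose a b \<in> edge_group r E e"
  unfolding edge_group_def
proof (intro CollectI conjI allI impI)
  show "transpose a b permutes e" using e by (simp add: permutes_swap_id)
  fix xs assume xs: "length xs = r" "set xs = e"
  have dist: "distinct xs" using xs E_card e card_distinct by metis
  obtain i where i: "i < r" "xs ! i = a" using e xs by (metis in_set_conv_nth)
  obtain j where j: "j < r" "xs ! j = b" using e xs by (metis in_set_conv_nth)
  have ij: "i \<noteq> j" using i j e by auto
  define T where "T = e - {a, b}"
  define st where "st u v = xs[i := u, j := v]" for u v
  have stlen: "length (st u v) = r" for u v unfolding st_def using xs by simp
  have stnth: "m < r \<Longrightarrow> st u v ! m = (if m = j then v else if m = i then u else xs ! m)" for m u v
    unfolding st_def using xs ij by (auto simp: nth_list_update)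
  have stset: "set (st u v) = insert u (insert v T)" for u v
  proof -
    have "set (st u v) = (\<lambda>m. st u v ! m) ` {..<r}" using stlen by (auto simp: set_conv_nth)
    also have "{..<r} = insert i (insert j ({..<r} - {i, j}))" using i j by auto
    also have "(\<lambda>m. st u v ! m) ` \<dots> = insert u (insert v ((\<lambda>m. st u v ! m) ` ({..<r} - {i, j})))"
      using stnth i j ij by simp
    also have "(\<lambda>m. st u v ! m) ` ({..<r} - {i, j}) = (\<lambda>m. xs ! m) ` ({..<r} - {i, j})"
      using stnth by (intro image_cong) auto
    also have "\<dots> = T"
    proof -
      have "inj_on (\<lambda>m. xs ! m) {..<r}" using dist xs by (auto simp: inj_on_nth)
      hence "(\<lambda>m. xs ! m) ` ({..<r} - {i, j}) = (\<lambda>m. xs ! m) ` {..<r} - (\<lambda>m. xs ! m) ` {i, j}"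
        using i j by (intro inj_on_image_set_diff) auto
      also have "(\<lambda>m. xs ! m) ` {..<r} = e" using xs by (auto simp: set_conv_nth)
      finally show ?thesis using i j unfolding T_def by simp
    qed
    finally show ?thesis .
  qed
  have st0: "st a b = xs" unfolding st_def using i j by (metis list_update_id)
  have stba: "st b a = map (transpose a b) xs"
  proof (rule nth_equalityI)
    fix m assume "m < length (st b a)"
    hence m: "m < r" using stlen by simp
    have "m \<noteq> i \<Longrightarrow> xs ! m \<noteq> a" "m \<noteq> j \<Longrightarrow> xs ! m \<noteq> b" using dist m i j xs by (auto simp: nth_eq_iff_index_eq)
    thus "st b a ! m = map (transpose a b) xs ! m" using stnth m i j xs
      by (auto simp: transpose_def)
  qed (simp add: stlen xs)
  \<comment> \<open>The ordered link edges \<open>(u, v)\<close> for which the ordering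
    \<open>st u v\<close>, agreeing with \<open>xs\<close> away from \<open>i\<close> and
    \<open>j\<close>, is reachable.\<close>
  define D where "D u v \<longleftrightarrow> (xs, st u v) \<in> (repl r E)\<^sup>* \<and> insert u (insert v T) \<in> E \<and> u \<notin> T \<and> v \<notin> T \<and> u \<noteq> v" for u v
  have "insert a (insert b T) = e" unfolding T_def using e by auto
  hence D0: "D a b" unfolding D_def st0 using e by (auto simp: T_def)
  have Dl: "D u' v" if "D u v" "insert u' (insert v T) \<in> E" "u' \<notin> T" "u' \<noteq> v"
    for u u' v
  proof -
    have "(st u v, st u' v) \<in> repl r E"
      by (rule repl_nth[where j = i]) (use that i stlen stset stnth in \<open>auto simp: D_def\<close>)
    thus ?thesis using that unfolding D_def by (auto intro: rtrancl_into_rtrancl)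
  qed
  have Dr: "D u v'" if "D u v" "insert u (insert v' T) \<in> E" "v' \<notin> T" "v' \<noteq> u"
    for u v' v
  proof -
    have "(st u v, st u v') \<in> repl r E"
      by (rule repl_nth[where j = j]) (use that j stlen stset stnth in \<open>auto simp: D_def\<close>)
    thus ?thesis using that unfolding D_def by (auto intro: rtrancl_into_rtrancl)
  qed
  have stswap: "(st u v)[i := st u v ! j, j := st u v ! i] = st v u" for u v
    by (rule nth_equalityI) (use stlen stnth i j ij in \<open>auto simp: nth_list_update\<close>)
  have "(xs, st b a) \<in> (repl r E)\<^sup>*"
  proof (rule ccontr)
    assume no: "(xs, st b a) \<notin> (repl r E)\<^sup>*"
    define U where "U = {u. \<exists>v. D u v}"
    define U' where "U' = {v. \<exists>u. D u v}"
    \<comment> \<open>Suppose \<open>(u, v)\<close> and \<open>(w, u)\<close> are both reached.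
      Exchanging the positions in the chain to \<open>(u, v)\<close> leads from
      \<open>(b, a)\<close> to \<open>(v, u)\<close>, while replacing \<open>w\<close> by
      \<open>v\<close> reaches \<open>(v, u)\<close> from \<open>xs\<close>. So
      \<open>(b, a)\<close> would be reached.\<close>
    have UU: "U \<inter> U' = {}"
    proof (rule ccontr)
      assume "U \<inter> U' \<noteq> {}"
      then obtain u v w where uv: "D u v" "D w u" unfolding U_def U'_def by blast
      have "(st b a, st v u) \<in> (repl r E)\<^sup>*"
        using repl_swap_positions[of xs "st u v" r E i j] uv i j
          stswap[of u v] stswap[of a b] unfolding D_def st0 by simp
      moreover have "D v u"
        by (rule Dl[OF uv(2)]) (use uv in \<open>auto simp: D_def insert_commute\<close>)
      ultimately show False using no repl_rtrancl_sym unfolding D_def by (metis rtrancl_trans)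
    qed
    have TV: "T \<subseteq> V" "finite T" "card T + 2 = r"
    proof -
      show "T \<subseteq> V" using E_sub e unfolding T_def by auto
      thus "finite T" using finV finite_subset by blast
      have "card (e - {a, b}) = card e - card {a, b}" using e by (intro card_Diff_subset) auto
      thus "card T + 2 = r" unfolding T_def using e E_card r2 by simp
    qed
    define N where "N u = nbrs E (insert u T)" for u
    have bN: "card V < 3 * card (N u)" if "u \<in> V" "u \<notin> T" for u
      unfolding N_def using that TV by (intro codeg) auto
    have Nin: "u' \<in> V \<and> u' \<notin> T \<and> u' \<noteq> u \<and> insert u (insert u' T) \<in> E \<and> insert u' (insert u T) \<in> E" if "u' \<in> N u" for u u'
    proof -
      have "insert u' (insert u T) \<in> E" using that unfolding N_def nbrs_def by blast
      moreover have "insert u (insert u' T) = insert u' (insert u T)" by auto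
      ultimately show ?thesis using that E_sub unfolding N_def nbrs_def by auto
    qed
    have NU: "N u \<subseteq> U'" if uU: "u \<in> U" for u
    proof
      fix v assume v: "v \<in> N u"
      obtain w where "D u w" using uU unfolding U_def by blast
      hence "D u v" by (rule Dr) (use Nin[OF v] in auto)
      thus "v \<in> U'" unfolding U'_def by blast
    qed
    have NU': "N u \<subseteq> U" if uU: "u \<in> U'" for u
    proof
      fix v assume v: "v \<in> N u"
      obtain w where "D w u" using uU unfolding U'_def by blast
      hence "D v u" by (rule Dl) (use Nin[OF v] in auto)
      thus "v \<in> U" unfolding U_def by blast
    qed
    have aU: "a \<in> U" "b \<in> U'" using D0 unfolding U_def U'_def by auto
    have abV: "a \<in> V" "b \<in> V" "a \<notin> T" "b \<notin> T" using e E_sub unfolding T_def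
      by auto
    \<comment> \<open>The neighbourhoods of \<open>a\<close> and \<open>b\<close> lie in the
      disjoint sets \<open>U'\<close> and \<open>U\<close>. The neighbourhood of a vertex outside
      both avoids both, which gives three disjoint sets of more than a third of the
      vertices.\<close>
    have all: "w \<in> U \<union> U'" if w: "w \<in> V" "w \<notin> T" for w
    proof (rule ccontr)
      assume nw: "w \<notin> U \<union> U'"
      have sy: "w \<in> N u" if "u \<in> N w" for u
      proof -
        have "u \<notin> T" "u \<noteq> w" "insert w (insert u T) \<in> E" using Nin[OF that]
          by auto
        thus ?thesis using w unfolding N_def nbrs_def by auto
      qed
      have dis: "N w \<inter> U = {}" "N w \<inter> U' = {}" using sy NU NU' nw by blast+
      have sub: "N a \<subseteq> U'" "N b \<subseteq> U" using NU NU' aU by auto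
      have fin: "finite (N u)" for u using Nin finV by (metis finite_subset subsetI)
      have d3: "N a \<inter> N b = {}" "(N a \<union> N b) \<inter> N w = {}" using dis sub UU
        by blast+
      have "card (N a \<union> N b \<union> N w) = card (N a) + card (N b) + card (N w)"
        using fin d3 by (simp add: card_Un_disjoint)
      moreover have "card (N a \<union> N b \<union> N w) \<le> card V"
        using Nin finV by (intro card_mono) auto
      ultimately show False using bN[of a] bN[of b] bN[of w] abV w by linarith
    qed
    have "link_bipartite E T"
      unfolding link_bipartite_def
    proof (intro exI[of _ U] allI impI)
      fix u v assume uv: "u \<notin> T" "v \<notin> T" "u \<noteq> v" "insert u (insert v T) \<in> E"
      have V: "u \<in> V" "v \<in> V" using E_sub[OF uv(4)] by auto
      have n: "u \<in> N v" "v \<in> N u" using uv unfolding N_def nbrs_def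
        by (auto simp: insert_commute)
      show "u \<in> U \<longleftrightarrow> v \<notin> U" using all[of u] all[of v] V uv NU NU' n UU
        by blast
    qed
    thus False using nb unfolding T_def by simp
  qed
  thus "(xs, map (transpose a b) xs) \<in> (repl r E)\<^sup>*" using stba by simp
qed

text \<open>\<open>a\<close>, \<open>b\<close>, \<open>c\<close> form a triangle in the link graph
  of \<open>e - {a, b}\<close>.\<close>

lemma not_link_bipartite_of_common_nbr:
  assumes e: "e \<in> E" "a \<in> e" "b \<in> e" "a \<noteq> b"
    and c: "c \<in> nbrs E (e - {a})" "c \<in> nbrs E (e - {b})"
  shows "\<not> link_bipartite E (e - {a, b})"
proof
  assume "link_bipartite E (e - {a, b})"
  then obtain U where U: "\<And>u v. u \<notin> e - {a, b} \<Longrightarrow> v \<notin> e - {a, b} \<Longrightarrow> u \<noteq> v \<Longrightarrow>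
      insert u (insert v (e - {a, b})) \<in> E \<Longrightarrow> (u \<in> U \<longleftrightarrow> v \<notin> U)"
    unfolding link_bipartite_def by blast
  have cn: "c \<notin> e" "c \<noteq> a" "c \<noteq> b" using c e unfolding nbrs_def by auto
  have s: "insert a (insert b (e - {a, b})) = e"
    "insert c (insert b (e - {a, b})) = insert c (e - {a})"
    "insert c (insert a (e - {a, b})) = insert c (e - {b})" using e by auto
  have cE: "insert c (e - {a}) \<in> E" "insert c (e - {b}) \<in> E" using c unfolding nbrs_def
    by auto
  have "a \<in> U \<longleftrightarrow> b \<notin> U" "c \<in> U \<longleftrightarrow> b \<notin> U" "c \<in> U \<longleftrightarrow> a \<notin> U"
    by (rule U; use e cn cE s in auto)+
  thus False by blast
qed

text \<open>If all three links were bipartite, no two of the neighbourhoods of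
  \<open>e - {a}\<close>, \<open>e - {b}\<close>, \<open>e - {c}\<close> could meet, but each
  contains more than a third of the vertices.\<close>

lemma one_of_three_not_bipartite:
  assumes e: "e \<in> E" "a \<in> e" "b \<in> e" "c \<in> e" "distinct [a, b, c]"
  shows "\<not> link_bipartite E (e - {a, b}) \<or> \<not> link_bipartite E (e - {a, c}) \<or> \<not> link_bipartite E (e - {b, c})"
proof (rule ccontr)
  assume n: "\<not> ?thesis"
  let ?N = "\<lambda>a. nbrs E (e - {a})"
  have d: "?N a \<inter> ?N b = {}" "?N a \<inter> ?N c = {}" "?N b \<inter> ?N c = {}"
    using n not_link_bipartite_of_common_nbr[of e] e by auto
  have sub: "?N a \<subseteq> V" for a using E_sub unfolding nbrs_def by blast
  have fin: "finite (?N a)" for a using sub finV finite_subset by blast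
  have eV: "e \<subseteq> V" "card e = r" "finite e" using e E_sub E_card finV finite_subset
    by blast+
  have b: "card V < 3 * card (?N u)" if "u \<in> e" for u
    using that eV by (intro codeg) auto
  have "card (?N a \<union> ?N b \<union> ?N c) = card (?N a) + card (?N b) + card (?N c)"
    using fin d by (simp add: card_Un_disjoint Int_Un_distrib2)
  moreover have "card (?N a \<union> ?N b \<union> ?N c) \<le> card V" using sub finV
    by (intro card_mono) auto
  ultimately show False using b[of a] b[of b] b[of c] e by linarith
qed

lemma transpose_edge_group_trans:
  assumes "transpose a b \<in> edge_group r E e" "transpose b c \<in> edge_group r E e" "distinct [a, b, c]"
  shows "transpose a c \<in> edge_group r E e"
proof -
  have "transpose a c = transpose a b \<circ> transpose b c \<circ> transpose a b"
    using assms(3) by (auto simp: fun_eq_iff transpose_def)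
  thus ?thesis using edge_group_comp assms by metis
qed

end

section \<open>The two codegree thresholds\<close>

lemma not_free_of_codegree_gt_third:
  fixes H :: "nat hypergraph"
  assumes H: "r_graph r H" and r: "r \<ge> 2" and k: "\<not> [k = 0] (mod r)"
    and n: "r \<le> card (verts H)"
    and codeg: "\<And>S. S \<subseteq> verts H \<Longrightarrow> card S = r - 1 \<Longrightarrow> card (verts H) < 3 * card (nbrs (edges H) S)"
    and d: "odd (r div gcd r k)"
  shows "\<not> family_free (hom_family r (tight_cycle_family r k)) H"
proof
  assume free: "family_free (hom_family r (tight_cycle_family r k)) H"
  define V where "V = verts H"
  define E where "E = edges H"
  define d where "d = r div gcd r k"
  interpret codegree_third V E r
    using H r codeg unfolding V_def E_def by unfold_locales (auto simp: r_graph_def)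
  have k0: "k > 0" using k by (cases k) auto
  have dr: "d dvd r" "odd d" unfolding d_def
    using assms(6) dvd_triv_left[of "r div gcd r k" "gcd r k"] by simp_all
  have noblock: False if e: "e \<in> E" "P \<subseteq> e" "d dvd card P"
    and tr: "\<And>a b. a \<in> e \<Longrightarrow> b \<in> e \<Longrightarrow> a \<noteq> b \<Longrightarrow> (a \<in> P \<longleftrightarrow> b \<in> P) \<Longrightarrow> transpose a b \<in> edge_group r E e" for e P
  proof -
    have "finite e" "card e = r" using e E_sub E_card finV finite_subset by blast+
    hence "\<exists>xs. length xs = r \<and> set xs = e \<and> (xs, rotate k xs) \<in> (repl r E)\<^sup>*"
      using r by (intro rotate_block_reachable[OF _ _ e(2) _ e(3)[unfolded d_def] tr]) simp_all
    then obtain xs where xs: "length xs = r" "set xs = e" "(xs, rotate k xs) \<in> (repl r E)\<^sup>*" by blast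
    have "\<not> family_free (hom_family r (tight_cycle_family r k)) H"
      by (rule not_free_of_repl_rotate[OF H _ xs(1) _ xs(3)[unfolded E_def] k0])
        (use xs r e in \<open>auto simp: E_def\<close>)
    thus False using free by simp
  qed
  \<comment> \<open>For \<open>r = 2\<close> the residue \<open>k\<close> is odd and
    \<open>r div gcd r k = 2\<close>, which is even.\<close>
  have r3: "r \<ge> 3"
  proof (rule ccontr)
    assume "\<not> r \<ge> 3"
    hence r2: "r = 2" using r by simp
    hence "odd k" using k by (auto simp: Cong.cong_def)
    hence "gcd r k = 1" using r2 by (simp add: coprime_iff_gcd_eq_1[symmetric])
    thus False using \<open>odd (r div gcd r k)\<close> r2 by simp
  qed
  define red where "red T \<longleftrightarrow> \<not> link_bipartite E T" for T
  \<comment> \<open>Redness suffices for a reachable transposition but is not known to be necessary,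
    so composing transpositions does not prove this. Instead, if \<open>{a, c}\<close> is not red,
    every further \<open>y\<close> is red with \<open>a\<close> or \<open>c\<close> and thus
    connected to \<open>b\<close>. Then all transpositions are reachable, and the empty block
    contradicts freeness.\<close>
  have trans: "red (e - {a, c})"
    if e: "e \<in> E" "a \<in> e" "b \<in> e" "c \<in> e" "distinct [a, b, c]"
    and ab: "red (e - {a, b})" and bc: "red (e - {b, c})"
    for e a b c
  proof (rule ccontr)
    assume ac: "\<not> red (e - {a, c})"
    have tab: "transpose a b \<in> edge_group r E e" and tbc: "transpose b c \<in> edge_group r E e"
      using transpose_in_edge_group e ab bc unfolding red_def by auto
    have tac: "transpose a c \<in> edge_group r E e" using transpose_edge_group_trans[OF tab tbc] e
      by simp
    have tb: "transpose b y \<in> edge_group r E e" if y: "y \<in> e" "y \<noteq> b" for y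
    proof (cases "y = a \<or> y = c")
      case True thus ?thesis using tab tbc by (metis transpose_commute)
    next
      case False
      hence "red (e - {a, y}) \<or> red (e - {c, y})"
        using one_of_three_not_bipartite[of e a c y] e y ac unfolding red_def by auto
      thus ?thesis
      proof
        assume "red (e - {a, y})"
        hence "transpose a y \<in> edge_group r E e"
          using transpose_in_edge_group[of e a y] e y False unfolding red_def by auto
        thus ?thesis using transpose_edge_group_trans[of b a e y] tab e y False
          by (auto simp: transpose_commute)
      next
        assume "red (e - {c, y})"
        hence "transpose c y \<in> edge_group r E e"
          using transpose_in_edge_group[of e c y] e y False unfolding red_def by auto
        thus ?thesis using transpose_edge_group_trans[of b c e y] tbc e y False by auto
      qed
    qed
    have "transpose y y' \<in> edge_group r E e" if "y \<in> e" "y' \<in> e" "y \<noteq> y'"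
      for y y'
      using tb[of y] tb[of y'] transpose_edge_group_trans[of y b e y'] that
      by (cases "y = b"; cases "y' = b") (auto simp: transpose_commute)
    thus False using noblock[of e "{}"] e by auto
  qed
  interpret two_block_colouring V E r red
  proof
    fix a b c :: nat and W
    assume E: "insert a (insert b (insert c W)) \<in> E" and abc: "distinct [a, b, c]"
    and W: "a \<notin> W" "b \<notin> W" "c \<notin> W"
    define e where "e = insert a (insert b (insert c W))"
    have s: "e - {a, b} = insert c W" "e - {a, c} = insert b W" "e - {b, c} = insert a W"
      unfolding e_def using abc W by auto
    have s': "e - {b, a} = insert c W" "e - {c, a} = insert b W" "e - {c, b} = insert a W" using s
      by (auto simp: insert_commute)
    have ine: "e \<in> E" "a \<in> e" "b \<in> e" "c \<in> e" using E unfolding e_def by auto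
    note o = one_of_three_not_bipartite[OF ine abc, folded red_def, unfolded s]
    have t1: "red (insert c W) \<Longrightarrow> red (insert a W) \<Longrightarrow> red (insert b W)"
      using trans[of e a b c] ine abc s by simp
    have t2: "red (insert b W) \<Longrightarrow> red (insert a W) \<Longrightarrow> red (insert c W)"
      using trans[of e a c b] ine abc s s' by auto
    have t3: "red (insert c W) \<Longrightarrow> red (insert b W) \<Longrightarrow> red (insert a W)"
      using trans[of e b a c] ine abc s s' by auto
    show "red (insert c W) \<longleftrightarrow> (red (insert a W) \<longleftrightarrow> red (insert b W))" using o t1 t2 t3 by blast
  qed (use finV E_sub E_card r3 n codeg in \<open>auto simp: V_def E_def\<close>)
  obtain e P where B: "block e P" "d dvd card P" using block_divisible[OF dr(2,1)] by blast
  have "transpose a b \<in> edge_group r E e"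
    if "a \<in> e" "b \<in> e" "a \<noteq> b" "a \<in> P \<longleftrightarrow> b \<in> P" for a b
    using B that transpose_in_edge_group[of e a b] unfolding block_def red_def by blast
  thus False using noblock[of e P] B unfolding block_def by blast
qed

text \<open>For \<open>a\<close>, \<open>b\<close> in an edge \<open>e\<close> the neighbourhoods of
  \<open>e - {a}\<close> and \<open>e - {b}\<close> meet, so every transposition of \<open>e\<close>
  is reachable. The rotation by \<open>k\<close> is then obtained from the empty block, whose size
  every number divides.\<close>

lemma not_free_of_codegree_gt_half:
  fixes H :: "nat hypergraph"
  assumes H: "r_graph r H" and r: "r \<ge> 2" and k: "\<not> [k = 0] (mod r)"
    and n: "r \<le> card (verts H)"
    and codeg: "\<And>S. S \<subseteq> verts H \<Longrightarrow> card S = r - 1 \<Longrightarrow> card (verts H) < 2 * card (nbrs (edges H) S)"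
  shows "\<not> family_free (hom_family r (tight_cycle_family r k)) H"
proof -
  define V where "V = verts H"
  define E where "E = edges H"
  have codeg3: "card (verts H) < 3 * card (nbrs (edges H) S)"
    if "S \<subseteq> verts H" "card S = r - 1" for S
    using codeg[OF that] by linarith
  interpret codegree_third V E r
    using H r codeg3 unfolding V_def E_def by unfold_locales (auto simp: r_graph_def)
  have k0: "k > 0" using k by (cases k) auto
  obtain S where S: "S \<subseteq> V" "card S = r - 1"
    using n unfolding V_def by (metis diff_le_self le_trans obtain_subset_with_card_n)
  have "nbrs E S \<noteq> {}" using codeg[OF S] by auto
  then obtain v where v: "insert v S \<in> E" unfolding nbrs_def by blast
  define e where "e = insert v S"
  have eE: "e \<in> E" using v unfolding e_def .
  have e: "e \<in> E" "e \<subseteq> V" "card e = r" "finite e"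
    using eE E_sub[OF eE] E_card[OF eE] finite_subset[OF E_sub[OF eE] finV] by simp_all
  have tr: "transpose a b \<in> edge_group r E e" if ab: "a \<in> e" "b \<in> e" "a \<noteq> b"
    for a b
  proof -
    let ?N = "\<lambda>a. nbrs E (e - {a})"
    have sub: "?N a \<subseteq> V" for a using E_sub unfolding nbrs_def by blast
    have fin: "finite (?N a)" for a using sub finV finite_subset by blast
    have b: "card V < 2 * card (?N u)" if "u \<in> e" for u
      using that e assms(5)[of "e - {u}"] unfolding V_def E_def by auto
    have "?N a \<inter> ?N b \<noteq> {}"
    proof
      assume "?N a \<inter> ?N b = {}"
      hence "card (?N a \<union> ?N b) = card (?N a) + card (?N b)" using fin
        by (simp add: card_Un_disjoint)
      moreover have "card (?N a \<union> ?N b) \<le> card V" using sub finV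
        by (intro card_mono) auto
      ultimately show False using b[of a] b[of b] ab by linarith
    qed
    thus ?thesis using not_link_bipartite_of_common_nbr transpose_in_edge_group ab e by blast
  qed
  have "\<exists>xs. length xs = r \<and> set xs = e \<and> (xs, rotate k xs) \<in> (repl r E)\<^sup>*"
    by (rule rotate_block_reachable[where P = "{}"]) (use e r tr in auto)
  then obtain xs where "length xs = r" "set xs = e" "(xs, rotate k xs) \<in> (repl r E)\<^sup>*"
    by blast
  note xs = this
  show ?thesis
    by (rule not_free_of_repl_rotate[OF H _ xs(1) _ xs(3)[unfolded E_def] k0])
      (use xs r e in \<open>auto simp: E_def\<close>)
qed

subsection \<open>Extremal numbers and the parity construction\<close>

lemma card_edges_containing:
  assumes H: "r_graph r H" and r: "r > 0" and S: "S \<subseteq> verts H" "card S = r - 1"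
  shows "card {e \<in> edges H. S \<subseteq> e} = card (nbrs (edges H) S)"
proof -
  have fS: "finite S" using S H finite_subset unfolding r_graph_def by blast
  have "bij_betw (\<lambda>v. insert v S) (nbrs (edges H) S) {e \<in> edges H. S \<subseteq> e}"
    unfolding bij_betw_def
  proof
    show "inj_on (\<lambda>v. insert v S) (nbrs (edges H) S)"
      by (rule inj_onI) (auto simp: nbrs_def)
    show "(\<lambda>v. insert v S) ` nbrs (edges H) S = {e \<in> edges H. S \<subseteq> e}"
    proof
      show "{e \<in> edges H. S \<subseteq> e} \<subseteq> (\<lambda>v. insert v S) ` nbrs (edges H) S"
      proof clarify
        fix e assume e: "e \<in> edges H" "S \<subseteq> e"
        hence ce: "card e = r" using H unfolding r_graph_def by blast
        have "card (e - S) = 1" using e ce S fS r by (simp add: card_Diff_subset)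
        then obtain v where "e - S = {v}" by (metis card_1_singletonE)
        hence "v \<notin> S" "insert v S = e" using e by auto
        thus "e \<in> (\<lambda>v. insert v S) ` nbrs (edges H) S" using e unfolding nbrs_def
          by auto
      qed
    qed (auto simp: nbrs_def)
  qed
  thus ?thesis using bij_betw_same_card by fastforce
qed

text \<open>With at least \<open>r\<close> vertices some set of size \<open>r - 1\<close> exists, so
  the \<open>Min\<close> runs over a nonempty finite set and behaves like a true minimum.\<close>

lemma min_codegree_nbrs:
  assumes H: "r_graph r H" and r: "r > 0" and n: "card (verts H) \<ge> r"
  shows "S \<subseteq> verts H \<Longrightarrow> card S = r - 1 \<Longrightarrow> min_codegree r H \<le> card (nbrs (edges H) S)"
    and "(\<And>S. S \<subseteq> verts H \<Longrightarrow> card S = r - 1 \<Longrightarrow> m \<le> card (nbrs (edges H) S)) \<Longrightarrow> m \<le> min_codegree r H"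
    and "min_codegree r H \<le> card (verts H)"
proof -
  let ?C = "{card {e \<in> edges H. S \<subseteq> e} | S. S \<subseteq> verts H \<and> card S = r - 1}"
  have C: "?C = (\<lambda>S. card (nbrs (edges H) S)) ` {S. S \<subseteq> verts H \<and> card S = r - 1}"
    unfolding setcompr_eq_image
    by (rule image_cong[OF refl]) (use card_edges_containing[OF H r] in blast)
  have fV: "finite (verts H)" using H unfolding r_graph_def by blast
  have fin: "finite ?C" unfolding C using fV by auto
  obtain S0 where S0: "S0 \<subseteq> verts H" "card S0 = r - 1"
    using n by (metis diff_le_self le_trans obtain_subset_with_card_n)
  hence ne: "?C \<noteq> {}" by blast
  show 1: "min_codegree r H \<le> card (nbrs (edges H) S)"
    if "S \<subseteq> verts H" "card S = r - 1" for S
    unfolding min_codegree_def C by (rule Min_le) (use fin[unfolded C] that in auto)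
  show "m \<le> min_codegree r H"
    if "\<And>S. S \<subseteq> verts H \<Longrightarrow> card S = r - 1 \<Longrightarrow> m \<le> card (nbrs (edges H) S)"
    unfolding min_codegree_def C
    by (rule Min.boundedI[OF fin[unfolded C] ne[unfolded C]]) (use that in auto)
  have "nbrs (edges H) S0 \<subseteq> verts H" using H unfolding nbrs_def r_graph_def by blast
  thus "min_codegree r H \<le> card (verts H)" using 1[OF S0] card_mono[OF fV] le_trans by blast
qed

text \<open>The edgeless hypergraph is free and codegrees are at most \<open>n\<close>, so the
  \<open>Max\<close> runs over a nonempty finite set of numbers.\<close>

lemma codegree_ex_attained:
  fixes H :: "nat hypergraph"
  assumes r: "r > 0" and n: "n \<ge> r"
  shows "\<exists>H :: nat hypergraph. r_graph r H \<and> card (verts H) = n \<and>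
      family_free (hom_family r (tight_cycle_family r k)) H \<and>
      min_codegree r H = codegree_ex r n (hom_family r (tight_cycle_family r k))"
    and "r_graph r H \<Longrightarrow> card (verts H) = n \<Longrightarrow> family_free (hom_family r (tight_cycle_family r k)) H \<Longrightarrow>
      min_codegree r H \<le> codegree_ex r n (hom_family r (tight_cycle_family r k))"
proof -
  let ?F = "hom_family r (tight_cycle_family r k)"
  let ?C = "{min_codegree r H | H :: nat hypergraph. r_graph r H \<and> card (verts H) = n \<and> family_free ?F H}"
  have "?C \<subseteq> {..n}" using min_codegree_nbrs(3)[OF _ r] n by auto
  hence fin: "finite ?C" using finite_subset by blast
  define H0 :: "nat hypergraph" where "H0 = \<lparr> verts = {0..<n}, edges = {} \<rparr>"
  have H0: "r_graph r H0" "card (verts H0) = n" unfolding H0_def r_graph_def by auto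
  have "family_free ?F H0"
    by (subst free_iff_no_tight_cycle_hom[OF H0(1)]) (auto simp: hypergraph_hom_def tight_cycle_def H0_def)
  hence ne: "?C \<noteq> {}" using H0 by blast
  show "\<exists>H :: nat hypergraph. r_graph r H \<and> card (verts H) = n \<and> family_free ?F H \<and>
      min_codegree r H = codegree_ex r n ?F"
    using Max_in[OF fin ne] unfolding codegree_ex_def by auto
  show "min_codegree r H \<le> codegree_ex r n ?F"
    if "r_graph r H" "card (verts H) = n" "family_free ?F H" for H :: "nat hypergraph"
    unfolding codegree_ex_def by (rule Max_ge[OF fin]) (use that in blast)
qed

section \<open>Periodic sequences and the parity construction\<close>

lemma periodic_mult:
  fixes f :: "nat \<Rightarrow> 'a"
  assumes "\<And>i. f (i + g) = f i"
  shows "f (i + m * g) = f i"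
proof (induction m)
  case (Suc m)
  have "f (i + Suc m * g) = f ((i + m * g) + g)" by (simp add: algebra_simps)
  thus ?case using assms Suc by simp
qed simp

lemma periodic_sum:
  fixes f :: "nat \<Rightarrow> nat"
  assumes "\<And>i. f (i + g) = f i"
  shows "(\<Sum>j<d * g. f j) = d * (\<Sum>j<g. f j)"
proof (induction d)
  case (Suc d)
  have "(\<Sum>j<Suc d * g. f j) = (\<Sum>j<d * g + g. f j)" by (simp add: add.commute)
  also have "\<dots> = (\<Sum>j<d * g. f j) + (\<Sum>j<g. f (d * g + j))"
  proof -
    have "(\<Sum>j<m + g. f j) = (\<Sum>j<m. f j) + (\<Sum>j<g. f (m + j))" for m g
      by (induction g) (simp_all add: add.assoc)
    thus ?thesis .
  qed
  also have "(\<Sum>j<g. f (d * g + j)) = (\<Sum>j<g. f j)"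
    using periodic_mult[of f g _ d, OF assms] by (simp add: add.commute)
  finally show ?case using Suc by simp
qed simp

text \<open>Along a tight cycle the indicator of \<open>A\<close> has an odd sum over each window of
  length \<open>r\<close>. This forces period \<open>r\<close>; together with the period
  \<open>l\<close> it gives period \<open>gcd r l = gcd r k\<close>. A window then consists of an
  even number of periods and its sum is even.\<close>

lemma odd_intersection_free:
  fixes H :: "nat hypergraph"
  assumes H: "r_graph r H" and r: "r > 0"
    and od: "\<And>e. e \<in> edges H \<Longrightarrow> odd (card (e \<inter> A))"
    and d: "even (r div gcd r k)"
  shows "family_free (hom_family r (tight_cycle_family r k)) H"
  unfolding free_iff_no_tight_cycle_hom[OF H]
proof clarify
  fix l \<phi> assume l: "l > r" "[l = k] (mod r)"
  and hom: "hypergraph_hom \<phi> (tight_cycle r l) H"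
  define x :: "nat \<Rightarrow> nat" where "x i = of_bool (\<phi> (i mod l) \<in> A)" for i
  have xl: "x (i + l) = x i" for i unfolding x_def by simp
  have win: "odd (\<Sum>j<r. x (i + j))" for i
  proof -
    let ?f = "\<lambda>j. \<phi> ((i + j) mod l)"
    have "(\<lambda>j. (i mod l + j) mod l) ` {0..<r} \<in> edges (tight_cycle r l)"
      unfolding tight_cycle_def using l by force
    hence "\<phi> ` (\<lambda>j. (i mod l + j) mod l) ` {0..<r} \<in> edges H" using hom
      unfolding hypergraph_hom_def by blast
    moreover have "\<phi> ` (\<lambda>j. (i mod l + j) mod l) ` {0..<r} = ?f ` {..<r}"
      unfolding image_image by (simp add: mod_add_left_eq lessThan_atLeast0)
    ultimately have E: "?f ` {..<r} \<in> edges H" by simp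
    hence "card (?f ` {..<r}) = r" using H unfolding r_graph_def by blast
    hence inj: "inj_on ?f {..<r}" by (intro eq_card_imp_inj_on) auto
    have "?f ` {..<r} \<inter> A = ?f ` {j \<in> {..<r}. ?f j \<in> A}" by auto
    hence "card (?f ` {..<r} \<inter> A) = card {j \<in> {..<r}. ?f j \<in> A}"
      using card_image[OF inj_on_subset[OF inj, of "{j \<in> {..<r}. ?f j \<in> A}"]] by auto
    also have "\<dots> = (\<Sum>j<r. x (i + j))"
      unfolding x_def by (simp add: sum.If_cases of_bool_def Int_def)
    finally show ?thesis using od[OF E] by simp
  qed
  \<comment> \<open>Consecutive windows differ only in their end terms, whose parities agree because
    both sums are odd; being \<open>0\<close> or \<open>1\<close>, the terms are equal.\<close>
  have xr: "x (i + r) = x i" for i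
  proof -
    have "(\<Sum>j<r. x (i + j)) + x (i + r) = (\<Sum>j<Suc r. x (i + j))" by simp
    also have "\<dots> = x i + (\<Sum>j<r. x (Suc i + j))" by (subst sum.lessThan_Suc_shift) simp
    finally have eq: "(\<Sum>j<r. x (i + j)) + x (i + r) = x i + (\<Sum>j<r. x (Suc i + j))" .
    hence "even (x (i + r)) \<longleftrightarrow> even (x i)" using win[of i] win[of "Suc i"]
      by (metis even_add)
    thus ?thesis unfolding x_def by (simp split: if_splits add: of_bool_def)
  qed
  define g where "g = gcd r k"
  have gl: "g = gcd r l" unfolding g_def using cong_gcd_eq[OF l(2)] by (simp add: gcd.commute)
  \<comment> \<open>Bezout in natural numbers: a shift by \<open>g\<close> followed by
    \<open>b\<close> shifts by \<open>l\<close> equals \<open>a\<close> shifts by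
    \<open>r\<close>.\<close>
  obtain a b where ab: "r * a = l * b + g" using bezout_nat[of r l] r gl by auto
  have xg: "x (i + g) = x i" for i
  proof -
    have "x (i + g) = x (i + g + b * l)" using periodic_mult[of x l, OF xl] by simp
    also have "\<dots> = x (i + a * r)" using ab by (simp add: algebra_simps)
    finally show ?thesis using periodic_mult[of x r, OF xr] by simp
  qed
  have "r = (r div g) * g" unfolding g_def by simp
  hence "(\<Sum>j<r. x j) = (r div g) * (\<Sum>j<g. x j)"
    using periodic_sum[of x g "r div g", OF xg] by simp
  hence "even (\<Sum>j<r. x j)" using d unfolding g_def by simp
  thus False using win[of 0] by simp
qed

text \<open>An \<open>(r - 1)\<close>-set meeting \<open>A\<close> in an even number of points is
  completed by any new vertex of \<open>A\<close>, otherwise by any new vertex outside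
  \<open>A\<close>. Both halves have at least \<open>n div 2\<close> vertices, of which the set
  itself occupies fewer than \<open>r\<close>.\<close>

lemma codegree_ex_lower:
  assumes r: "r > 0" and n: "n \<ge> r" and d: "even (r div gcd r k)"
  shows "n div 2 - r \<le> codegree_ex r n (hom_family r (tight_cycle_family r k))"
proof -
  define A where "A = {0..<n div 2}"
  define V where "V = {0..<n}"
  define H where "H = \<lparr> verts = V, edges = {e. e \<subseteq> V \<and> card e = r \<and> odd (card (e \<inter> A))} \<rparr>"
  have H: "r_graph r H" "card (verts H) = n" unfolding H_def r_graph_def V_def by auto
  have free: "family_free (hom_family r (tight_cycle_family r k)) H"
    by (rule odd_intersection_free[OF H(1) r _ d, where A = A]) (simp add: H_def)
  have "n div 2 - r \<le> min_codegree r H"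
  proof (rule min_codegree_nbrs(2)[OF H(1) r])
    fix S assume S: "S \<subseteq> verts H" "card S = r - 1"
    have fS: "finite S" "S \<subseteq> V" using S unfolding H_def V_def
      by (auto intro: finite_subset)
    define B where "B = (if even (card (S \<inter> A)) then A else V - A)"
    have AV: "A \<subseteq> V" "finite A" "card A = n div 2" "card V = n" unfolding A_def V_def
      by auto
    have B: "B \<subseteq> V" "finite B" "n div 2 \<le> card B"
      unfolding B_def using AV by (auto simp: card_Diff_subset V_def)
    have "B - S \<subseteq> nbrs (edges H) S"
    proof
      fix v assume v: "v \<in> B - S"
      have "odd (card (insert v S \<inter> A))"
        using v fS unfolding B_def
        by (cases "even (card (S \<inter> A))") (auto simp: Int_insert_left)
      thus "v \<in> nbrs (edges H) S" using v S fS B r unfolding nbrs_def H_def by auto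
    qed
    moreover have "nbrs (edges H) S \<subseteq> V" unfolding nbrs_def H_def by auto
    hence "finite (nbrs (edges H) S)" unfolding V_def using finite_subset by blast
    ultimately have "card (B - S) \<le> card (nbrs (edges H) S)" by (rule card_mono[rotated])
    moreover have "card B - card S \<le> card (B - S)" using fS by (intro diff_card_le_card_Diff)
    ultimately show "n div 2 - r \<le> card (nbrs (edges H) S)" using B(3) S(2) by linarith
  qed (use H n in simp)
  thus ?thesis using codegree_ex_attained(2)[OF r n H free] by linarith
qed

subsection \<open>Existence of the limit by sampling\<close>

text \<open>A Chernoff bound in counting form. Each map with fewer than \<open>t\<close> hits has
  weight \<open>x powr (- t) * x ^ hits\<close> at least \<open>1\<close>, and the sum of these
  weights over all maps factors over the coordinates.\<close>

lemma card_PiE_few_hits_le: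
  fixes x t :: real
  assumes B: "finite B" and V: "finite V" and W: "W \<subseteq> V" "\<delta> \<le> card W"
    and x: "0 < x" "x < 1"
  shows "real (card {h \<in> PiE B (\<lambda>_. V). real (card {j \<in> B. h j \<in> W}) < t})
    \<le> x powr (- t) * (real (card V) - real \<delta> * (1 - x)) ^ card B"
proof -
  let ?P = "PiE B (\<lambda>_. V)"
  let ?hits = "\<lambda>h. card {j \<in> B. h j \<in> W}"
  have finP: "finite ?P" using B V by (intro finite_PiE) auto
  have "real (card {h \<in> ?P. real (?hits h) < t}) = (\<Sum>h\<in>{h \<in> ?P. real (?hits h) < t}. 1)" by simp
  also have "\<dots> \<le> (\<Sum>h\<in>{h \<in> ?P. real (?hits h) < t}. x powr (- t) * x ^ ?hits h)"
  proof (rule sum_mono)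
    fix h assume h: "h \<in> {h \<in> ?P. real (?hits h) < t}"
    have "x powr t \<le> x powr real (?hits h)" using h x by (intro powr_mono') auto
    hence "x powr (- t) * x powr t \<le> x powr (- t) * x powr real (?hits h)"
      by (rule mult_left_mono) auto
    thus "1 \<le> x powr (- t) * x ^ ?hits h" using x by (simp add: powr_realpow flip: powr_add)
  qed
  also have "\<dots> \<le> (\<Sum>h\<in>?P. x powr (- t) * x ^ ?hits h)"
    using finP x by (intro sum_mono2) auto
  also have "\<dots> = x powr (- t) * (\<Sum>h\<in>?P. \<Prod>j\<in>B. if h j \<in> W then x else 1)"
    unfolding sum_distrib_left using B by (intro sum.cong refl) (simp add: prod.If_cases Int_def)
  also have "(\<Sum>h\<in>?P. \<Prod>j\<in>B. if h j \<in> W then x else 1) = (\<Prod>j\<in>B. \<Sum>v\<in>V. if v \<in> W then x else 1)"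
    using B V by (intro prod_sum_PiE[symmetric]) auto
  also have "(\<Sum>v\<in>V. if v \<in> W then x else 1) = real (card V) - real (card W) * (1 - x)"
  proof -
    have "card (V - W) = card V - card W" "card W \<le> card V"
      using W V by (auto simp: card_Diff_subset finite_subset card_mono)
    thus ?thesis using W V by (simp add: sum.If_cases Int_absorb1 Diff_eq[symmetric] algebra_simps)
  qed
  also have "(\<Prod>j\<in>B. real (card V) - real (card W) * (1 - x)) = (real (card V) - real (card W) * (1 - x)) ^ card B" by simp
  also have "\<dots> \<le> (real (card V) - real \<delta> * (1 - x)) ^ card B"
  proof (rule power_mono)
    show "real (card V) - real (card W) * (1 - x) \<le> real (card V) - real \<delta> * (1 - x)"
      using W x by (simp add: mult_right_mono)
    have "real (card W) * (1 - x) \<le> real (card V) * 1"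
      using W V x by (intro mult_mono) (auto simp: card_mono)
    thus "0 \<le> real (card V) - real (card W) * (1 - x)" by simp
  qed
  finally show ?thesis using x by (simp add: mult_left_mono)
qed

lemma card_bad_sample_le:
  fixes x t :: real
  assumes I: "finite I" "S \<subseteq> I" and V: "finite V"
    and E: "\<And>e. e \<in> E \<Longrightarrow> e \<subseteq> V"
    and codeg: "\<And>T. T \<subseteq> V \<Longrightarrow> card T = card S \<Longrightarrow> \<delta> \<le> card (nbrs E T)" and \<delta>: "\<delta> \<le> card V" and x: "0 < x" "x < 1"
  shows "real (card {f \<in> PiE I (\<lambda>_. V). inj_on f S \<and> real (card {j \<in> I - S. f j \<in> nbrs E (f ` S)}) < t})
    \<le> real (card V) ^ card S * (x powr (- t) * (real (card V) - real \<delta> * (1 - x)) ^ card (I - S))"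
proof -
  let ?B = "I - S"
  define G where "G = {g \<in> PiE S (\<lambda>_. V). inj_on g S}"
  define Q where "Q g = {h \<in> PiE ?B (\<lambda>_. V). real (card {j \<in> ?B. h j \<in> nbrs E (g ` S)}) < t}" for g
  let ?A = "{f \<in> PiE I (\<lambda>_. V). inj_on f S \<and> real (card {j \<in> ?B. f j \<in> nbrs E (f ` S)}) < t}"
  have fS: "finite S" using I finite_subset by blast
  have finG: "finite G" unfolding G_def using fS V by (auto intro!: finite_PiE)
  have finQ: "finite (Q g)" for g unfolding Q_def using I V
    by (intro finite_subset[OF _ finite_PiE[of ?B "\<lambda>_. V"]]) auto
  have inj: "inj_on (\<lambda>f. (restrict f S, restrict f ?B)) ?A"
  proof (rule inj_onI)
    fix f f' assume f: "f \<in> ?A" "f' \<in> ?A" "(restrict f S, restrict f ?B) = (restrict f' S, restrict f' ?B)"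
    have "f i = f' i" if "i \<in> I" for i
    proof (cases "i \<in> S")
      case True thus ?thesis using f(3) by (metis prod.inject restrict_apply')
    next
      case False thus ?thesis using f(3) that by (metis DiffI prod.inject restrict_apply')
    qed
    thus "f = f'" using f(1,2) by (intro PiE_ext[of f I]) auto
  qed
  have im: "(\<lambda>f. (restrict f S, restrict f ?B)) ` ?A \<subseteq> Sigma G Q"
  proof clarify
    fix f assume f: "f \<in> PiE I (\<lambda>_. V)" "inj_on f S" "real (card {j \<in> ?B. f j \<in> nbrs E (f ` S)}) < t"
    have "restrict f S \<in> G" unfolding G_def using f I by (auto simp: PiE_iff inj_on_def)
    moreover have "{j \<in> ?B. restrict f ?B j \<in> nbrs E (restrict f S ` S)} = {j \<in> ?B. f j \<in> nbrs E (f ` S)}"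
      by auto
    hence "restrict f ?B \<in> Q (restrict f S)" unfolding Q_def using f I by (auto simp: PiE_iff)
    ultimately show "restrict f S \<in> G \<and> restrict f ?B \<in> Q (restrict f S)" by blast
  qed
  let ?b = "x powr (- t) * (real (card V) - real \<delta> * (1 - x)) ^ card ?B"
  have Qb: "real (card (Q g)) \<le> ?b" if "g \<in> G" for g
    unfolding Q_def
  proof (rule card_PiE_few_hits_le)
    have "g ` S \<subseteq> V" "card (g ` S) = card S" using that unfolding G_def
      by (auto simp: card_image)
    thus "\<delta> \<le> card (nbrs E (g ` S))" by (rule codeg)
    show "nbrs E (g ` S) \<subseteq> V" using E unfolding nbrs_def by blast
  qed (use I V x in auto)
  have "real \<delta> * (1 - x) \<le> real (card V) * 1" using \<delta> x by (intro mult_mono) auto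
  hence b0: "0 \<le> ?b" by simp
  have "real (card ?A) \<le> real (card (Sigma G Q))"
    unfolding of_nat_le_iff by (rule card_inj_on_le[OF inj im]) (use finG finQ in auto)
  also have "\<dots> = (\<Sum>g\<in>G. real (card (Q g)))" using finG finQ
    by (simp add: card_SigmaI)
  also have "\<dots> \<le> real (card G) * ?b"
    using sum_bounded_above[of G "\<lambda>g. real (card (Q g))" ?b] Qb by simp
  also have "\<dots> \<le> real (card V) ^ card S * ?b"
  proof (rule mult_right_mono[OF _ b0])
    have "card G \<le> card (PiE S (\<lambda>_. V))" unfolding G_def using fS V
      by (intro card_mono finite_PiE) auto
    also have "\<dots> = card V ^ card S" using fS by (simp add: card_PiE)
    finally show "real (card G) \<le> real (card V) ^ card S" by (metis of_nat_le_iff of_nat_power)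
  qed
  finally show ?thesis .
qed

text \<open>Union bound over pairs \<open>i\<close>, \<open>j\<close> with equal values; such a map
  is determined by its restriction to \<open>I - {j}\<close>.\<close>

lemma card_noninjective_PiE_le:
  assumes I: "finite I" and V: "finite V"
  shows "card {f \<in> PiE I (\<lambda>_. V). \<not> inj_on f I} \<le> card I ^ 2 * card V ^ (card I - 1)"
proof -
  define A where "A ij = {f \<in> PiE I (\<lambda>_. V). f (fst ij) = f (snd ij)}" for ij
  define D where "D = {ij \<in> I \<times> I. fst ij \<noteq> snd ij}"
  have finD: "finite D" unfolding D_def using I by auto
  have finA: "finite (A ij)" for ij
    unfolding A_def using I V by (intro finite_subset[OF _ finite_PiE[of I "\<lambda>_. V"]]) auto
  have cA: "card (A ij) \<le> card V ^ (card I - 1)" if ij: "ij \<in> D" for ij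
  proof -
    obtain i j where ij': "ij = (i, j)" "i \<in> I" "j \<in> I" "i \<noteq> j" using ij
      unfolding D_def by auto
    let ?J = "I - {j}"
    have "inj_on (\<lambda>f. restrict f ?J) (A ij)"
    proof (rule inj_onI)
      fix f f' assume f: "f \<in> A ij" "f' \<in> A ij" "restrict f ?J = restrict f' ?J"
      have eq: "f l = f' l" if "l \<in> ?J" for l using f(3) that by (metis restrict_apply')
      have "f l = f' l" if "l \<in> I" for l
        using eq[of l] eq[of i] f(1,2) that ij' unfolding A_def by (cases "l = j") auto
      thus "f = f'" using f(1,2) unfolding A_def by (intro PiE_ext[of f I]) auto
    qed
    moreover have "(\<lambda>f. restrict f ?J) ` A ij \<subseteq> PiE ?J (\<lambda>_. V)"
      unfolding A_def by (auto intro!: restrict_PiE_iff[THEN iffD2])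
    ultimately have "card (A ij) \<le> card (PiE ?J (\<lambda>_. V))"
      using I V by (intro card_inj_on_le finite_PiE) auto
    also have "\<dots> = card V ^ (card I - 1)" using I ij' by (simp add: card_PiE)
    finally show ?thesis .
  qed
  have "{f \<in> PiE I (\<lambda>_. V). \<not> inj_on f I} \<subseteq> (\<Union>ij\<in>D. A ij)"
    unfolding A_def D_def inj_on_def by fastforce
  hence "card {f \<in> PiE I (\<lambda>_. V). \<not> inj_on f I} \<le> card (\<Union>ij\<in>D. A ij)"
    using finD finA by (intro card_mono) auto
  also have "\<dots> \<le> (\<Sum>ij\<in>D. card (A ij))" using finD by (rule card_UN_le)
  also have "\<dots> \<le> card D * card V ^ (card I - 1)"
    using sum_bounded_above[of D "\<lambda>ij. card (A ij)"] cA by simp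
  also have "card D \<le> card (I \<times> I)" unfolding D_def using I by (intro card_mono) auto
  hence "card D * card V ^ (card I - 1) \<le> card I ^ 2 * card V ^ (card I - 1)"
    by (intro mult_right_mono) (simp_all add: power2_eq_square card_cartesian_product)
  finally show ?thesis .
qed

text \<open>The Chernoff parameter is \<open>x = 1 - \<eta>\<close> with
  \<open>\<eta> = \<epsilon> / 4\<close>. From
  \<open>ln (1 - \<eta>) \<ge> - \<eta> - 2 * \<eta>\<^sup>2\<close> and
  \<open>1 - p * \<eta> \<le> exp (- (p * \<eta>))\<close> the coefficient of \<open>m\<close> is at
  most \<open>2 * \<eta>\<^sup>2 - \<epsilon> * \<eta> = - \<epsilon>\<^sup>2 / 8\<close>. The
  \<open>s\<close> fixed coordinates cost at most \<open>s\<close> in the exponent.\<close>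

lemma chernoff_exponent_le:
  fixes \<epsilon> p :: real and m s n \<delta> :: nat
  assumes \<epsilon>: "0 < \<epsilon>" "\<epsilon> < p" "p \<le> 1" and s: "s \<le> m"
    and p: "p = real \<delta> / real n" "n > 0"
  shows "real n ^ s * ((1 - \<epsilon> / 4) powr (- ((p - \<epsilon>) * real m)) * (real n - real \<delta> * (\<epsilon> / 4)) ^ (m - s))
    \<le> real n ^ m * exp (real s - \<epsilon>\<^sup>2 / 8 * real m)"
proof -
  define \<eta> where "\<eta> = \<epsilon> / 4"
  define t where "t = (p - \<epsilon>) * real m"
  have \<eta>: "0 < \<eta>" "\<eta> \<le> 1/4" unfolding \<eta>_def using \<epsilon> by auto
  have t0: "0 \<le> t" unfolding t_def using \<epsilon> by simp
  have "real n - real \<delta> * \<eta> = real n * (1 - p * \<eta>)" using p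
    by (simp add: field_simps)
  hence 1: "real n ^ s * (real n - real \<delta> * \<eta>) ^ (m - s) = real n ^ m * (1 - p * \<eta>) ^ (m - s)"
    using s by (simp add: power_mult_distrib mult.assoc[symmetric] flip: power_add)
  have pe: "p * \<eta> \<le> 1 * 1" using \<epsilon> \<eta> by (intro mult_mono) auto
  have "(1 - p * \<eta>) ^ (m - s) \<le> exp (- (p * \<eta>)) ^ (m - s)"
    using pe exp_ge_add_one_self[of "- (p * \<eta>)"] by (intro power_mono) auto
  also have "\<dots> = exp (- (p * \<eta>) * real (m - s))"
    by (simp add: exp_of_nat_mult[symmetric] mult.commute)
  finally have 2: "(1 - p * \<eta>) ^ (m - s) \<le> exp (- (p * \<eta>) * real (m - s))" .
  have "- \<eta> - 2 * \<eta>\<^sup>2 \<le> ln (1 - \<eta>)" using \<eta>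
    by (intro ln_one_minus_pos_lower_bound) auto
  hence "t * (- ln (1 - \<eta>)) \<le> t * (\<eta> + 2 * \<eta>\<^sup>2)" using t0
    by (intro mult_left_mono) auto
  hence 3: "(1 - \<eta>) powr (- t) \<le> exp (t * (\<eta> + 2 * \<eta>\<^sup>2))" using \<eta>
    unfolding powr_def by simp
  have "(1 - \<eta>) powr (- t) * (1 - p * \<eta>) ^ (m - s) \<le> exp (t * (\<eta> + 2 * \<eta>\<^sup>2)) * exp (- (p * \<eta>) * real (m - s))"
    using 2 3 pe by (intro mult_mono) auto
  also have "\<dots> = exp (t * (\<eta> + 2 * \<eta>\<^sup>2) - p * \<eta> * real (m - s))"
    by (simp flip: exp_add)
  also have "\<dots> \<le> exp (real s - \<epsilon>\<^sup>2 / 8 * real m)"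
  proof -
    have "t * (\<eta> + 2 * \<eta>\<^sup>2) - p * \<eta> * real (m - s)
        = real m * (2 * \<eta>\<^sup>2 * p - \<epsilon> * \<eta> - 2 * \<epsilon> * \<eta>\<^sup>2) + p * \<eta> * real s"
      using s by (simp add: t_def of_nat_diff algebra_simps)
    also have "\<dots> \<le> real m * (2 * \<eta>\<^sup>2 * 1 - \<epsilon> * \<eta>) + 1 * real s"
    proof (rule add_mono)
      have "2 * \<eta>\<^sup>2 * p \<le> 2 * \<eta>\<^sup>2 * 1" using \<epsilon>
        by (intro mult_left_mono) auto
      moreover have "0 \<le> 2 * \<epsilon> * \<eta>\<^sup>2" using \<epsilon> by simp
      ultimately show "real m * (2 * \<eta>\<^sup>2 * p - \<epsilon> * \<eta> - 2 * \<epsilon> * \<eta>\<^sup>2) \<le> real m * (2 * \<eta>\<^sup>2 * 1 - \<epsilon> * \<eta>)"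
        by (intro mult_left_mono) linarith+
      show "p * \<eta> * real s \<le> 1 * real s" using pe by (intro mult_right_mono) auto
    qed
    also have "\<dots> = real s - \<epsilon>\<^sup>2 / 8 * real m" unfolding \<eta>_def
      by (simp add: power2_eq_square field_simps)
    finally show ?thesis by simp
  qed
  finally have 4: "(1 - \<eta>) powr (- t) * (1 - p * \<eta>) ^ (m - s) \<le> exp (real s - \<epsilon>\<^sup>2 / 8 * real m)" .
  have "real n ^ s * ((1 - \<eta>) powr (- t) * (real n - real \<delta> * \<eta>) ^ (m - s))
      = (1 - \<eta>) powr (- t) * (real n ^ s * (real n - real \<delta> * \<eta>) ^ (m - s))" by simp
  also have "\<dots> = real n ^ m * ((1 - \<eta>) powr (- t) * (1 - p * \<eta>) ^ (m - s))"
    unfolding 1 by simp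
  also have "\<dots> \<le> real n ^ m * exp (real s - \<epsilon>\<^sup>2 / 8 * real m)" using 4
    by (intro mult_left_mono) auto
  finally show ?thesis unfolding \<eta>_def t_def .
qed

text \<open>Union bound among the \<open>n ^ m\<close> maps: fewer than half fail to be injective,
  by \<open>2 * m ^ 2 < n\<close>, and fewer than half are bad for one of the at most
  \<open>m ^ s\<close> sets \<open>S\<close>, by \<open>small\<close>.\<close>

lemma exists_good_sample:
  fixes \<epsilon> :: real and V :: "'a set"
  assumes V: "finite V" "card V = n" and E: "\<And>e. e \<in> E \<Longrightarrow> e \<subseteq> V"
    and codeg: "\<And>T. T \<subseteq> V \<Longrightarrow> card T = s \<Longrightarrow> \<delta> \<le> card (nbrs E T)" and \<delta>: "\<delta> \<le> n"
    and \<epsilon>: "0 < \<epsilon>" "\<epsilon> < real \<delta> / real n" and s: "s \<le> m"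
    and m: "m > 0"
    and n: "2 * m ^ 2 < n"
    and small: "real m ^ s * exp (real s - \<epsilon>\<^sup>2 / 8 * real m) < 1 / 2"
  shows "\<exists>f. inj_on f {0..<m} \<and> f ` {0..<m} \<subseteq> V \<and> (\<forall>S. S \<subseteq> {0..<m} \<longrightarrow> card S = s \<longrightarrow>
    (real \<delta> / real n - \<epsilon>) * real m \<le> real (card {j \<in> {0..<m} - S. f j \<in> nbrs E (f ` S)}))"
proof -
  define I where "I = {0..<m}"
  define P where "P = PiE I (\<lambda>_. V)"
  define p where "p = real \<delta> / real n"
  define t where "t = (p - \<epsilon>) * real m"
  define Ss where "Ss = {S. S \<subseteq> I \<and> card S = s}"
  define bad where "bad S = {f \<in> P. inj_on f S \<and> real (card {j \<in> I - S. f j \<in> nbrs E (f ` S)}) < t}" for S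
  define ni where "ni = {f \<in> P. \<not> inj_on f I}"
  have I: "finite I" "card I = m" unfolding I_def by auto
  have n0: "n > 0" using n by simp
  have p1: "p \<le> 1" unfolding p_def using \<delta> n0 by simp
  have finP: "finite P" unfolding P_def using I V by (intro finite_PiE) auto
  have cP: "card P = n ^ m" unfolding P_def using I V by (simp add: card_PiE)
  have finSs: "finite Ss" unfolding Ss_def using I by auto
  have cSs: "card Ss \<le> m ^ s" unfolding Ss_def
    using n_subsets[OF I(1), of s] I binomial_le_pow[OF s] by simp
  have cbad: "real (card (bad S)) \<le> real n ^ m * exp (real s - \<epsilon>\<^sup>2 / 8 * real m)"
    if "S \<in> Ss" for S
  proof -
    have S: "S \<subseteq> I" "card S = s" "finite S" using that I finite_subset unfolding Ss_def
      by auto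
    have "real (card (bad S)) \<le> real (card V) ^ card S *
        ((1 - \<epsilon> / 4) powr (- t) * (real (card V) - real \<delta> * (1 - (1 - \<epsilon> / 4))) ^ card (I - S))"
      unfolding bad_def P_def using \<epsilon> p1
      by (intro card_bad_sample_le) (use I S V E codeg \<delta> in \<open>auto simp: p_def\<close>)
    also have "\<dots> = real n ^ s * ((1 - \<epsilon> / 4) powr (- t) * (real n - real \<delta> * (\<epsilon> / 4)) ^ (m - s))"
      using S V I by (simp add: card_Diff_subset)
    also have "\<dots> \<le> real n ^ m * exp (real s - \<epsilon>\<^sup>2 / 8 * real m)"
      unfolding t_def
      by (rule chernoff_exponent_le) (use \<epsilon> p1 s n0 in \<open>auto simp: p_def\<close>)
    finally show ?thesis .
  qed
  have "real (card (ni \<union> (\<Union>S\<in>Ss. bad S))) < real (card P)"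
  proof -
    have "card (ni \<union> (\<Union>S\<in>Ss. bad S)) \<le> card ni + (\<Sum>S\<in>Ss. card (bad S))"
      using card_Un_le[of ni "\<Union>S\<in>Ss. bad S"] card_UN_le[OF finSs, of bad] by linarith
    hence "real (card (ni \<union> (\<Union>S\<in>Ss. bad S))) \<le> real (card ni) + (\<Sum>S\<in>Ss. real (card (bad S)))"
      by (metis of_nat_add of_nat_le_iff of_nat_sum)
    also have "real (card ni) < real n ^ m / 2"
    proof -
      have "card ni \<le> m ^ 2 * n ^ (m - 1)"
        unfolding ni_def P_def using card_noninjective_PiE_le[OF I(1) V(1)] I V by simp
      hence "2 * card ni \<le> (2 * m ^ 2) * n ^ (m - 1)" by simp
      also have "\<dots> < n * n ^ (m - 1)" using n n0 by simp
      also have "\<dots> = n ^ m" using m by (metis Suc_pred' power_Suc)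
      finally have "real (2 * card ni) < real (n ^ m)" by (rule less_imp_of_nat_less)
      thus ?thesis by simp
    qed
    also have "(\<Sum>S\<in>Ss. real (card (bad S))) \<le> real (card Ss) * (real n ^ m * exp (real s - \<epsilon>\<^sup>2 / 8 * real m))"
      using sum_bounded_above[of Ss "\<lambda>S. real (card (bad S))"] cbad by simp
    also have "\<dots> \<le> real m ^ s * (real n ^ m * exp (real s - \<epsilon>\<^sup>2 / 8 * real m))"
      using cSs by (intro mult_right_mono) (simp_all flip: of_nat_power)
    also have "\<dots> = real n ^ m * (real m ^ s * exp (real s - \<epsilon>\<^sup>2 / 8 * real m))"
      by simp
    also have "\<dots> \<le> real n ^ m * (1 / 2)" using small by (intro mult_left_mono) auto
    finally show ?thesis using cP by simp
  qed
  hence "\<not> P \<subseteq> ni \<union> (\<Union>S\<in>Ss. bad S)"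
    using finP finSs card_mono[of "ni \<union> (\<Union>S\<in>Ss. bad S)" P]
    by (auto simp: ni_def bad_def)
  then obtain f where f: "f \<in> P" "f \<notin> ni" "\<And>S. S \<in> Ss \<Longrightarrow> f \<notin> bad S" by blast
  have inj: "inj_on f I" using f unfolding ni_def by blast
  have "t \<le> real (card {j \<in> I - S. f j \<in> nbrs E (f ` S)})"
    if S: "S \<subseteq> I" "card S = s" for S
  proof (rule ccontr)
    assume "\<not> ?thesis"
    hence "f \<in> bad S" using f(1) inj_on_subset[OF inj S(1)] unfolding bad_def by auto
    thus False using f(3)[of S] S unfolding Ss_def by auto
  qed
  moreover have "f ` I \<subseteq> V" using f(1) unfolding P_def by auto
  ultimately show ?thesis using inj unfolding I_def t_def p_def by blast
qed

text \<open>An extremal host on \<open>n\<close> vertices is pulled back along a good sample of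
  \<open>m\<close> vertices. The relative codegrees drop by at most \<open>\<epsilon>\<close>, and
  freeness persists since composing with the sample map sends cycles to cycles.\<close>

lemma codegree_ratio_almost_decreasing:
  fixes \<epsilon> :: real
  assumes r: "r > 0" and \<epsilon>: "0 < \<epsilon>" and m: "m \<ge> r"
    and n: "n \<ge> r" "2 * m ^ 2 < n"
    and small: "real m ^ (r - 1) * exp (real (r - 1) - \<epsilon>\<^sup>2 / 8 * real m) < 1 / 2"
  shows "codegree_ratio r (hom_family r (tight_cycle_family r k)) n - \<epsilon>
    \<le> codegree_ratio r (hom_family r (tight_cycle_family r k)) m"
proof -
  let ?F = "hom_family r (tight_cycle_family r k)"
  obtain H :: "nat hypergraph" where H: "r_graph r H" "card (verts H) = n" "family_free ?F H"
    and Hm: "min_codegree r H = codegree_ex r n ?F" using codegree_ex_attained(1)[OF r n(1)]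
    by blast
  define \<delta> where "\<delta> = codegree_ex r n ?F"
  have ra: "codegree_ratio r ?F n = real \<delta> / real n"
    unfolding codegree_ratio_def \<delta>_def ..
  have rm0: "0 \<le> codegree_ratio r ?F m" unfolding codegree_ratio_def by simp
  have m0: "m > 0" using m r by simp
  show ?thesis
  proof (cases "\<epsilon> < real \<delta> / real n")
    case False thus ?thesis using ra rm0 by linarith
  next
    case True
    have fV: "finite (verts H)" using H unfolding r_graph_def by blast
    have \<delta>n: "\<delta> \<le> n" using min_codegree_nbrs(3)[OF H(1) r] H Hm n
      unfolding \<delta>_def by simp
    have cd: "\<delta> \<le> card (nbrs (edges H) T)" if "T \<subseteq> verts H" "card T = r - 1"
      for T
      using min_codegree_nbrs(1)[OF H(1) r _ that] H Hm n unfolding \<delta>_def by simp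
    have Es: "e \<subseteq> verts H" if "e \<in> edges H" for e using H(1) that
      unfolding r_graph_def by blast
    have sm: "r - 1 \<le> m" using m by simp
    obtain f where f: "inj_on f {0..<m}" "f ` {0..<m} \<subseteq> verts H"
      "\<And>S. S \<subseteq> {0..<m} \<Longrightarrow> card S = r - 1 \<Longrightarrow>
        (real \<delta> / real n - \<epsilon>) * real m \<le> real (card {j \<in> {0..<m} - S. f j \<in> nbrs (edges H) (f ` S)})"
      using exists_good_sample[OF fV H(2) Es cd \<delta>n \<epsilon> True sm m0 n(2) small] by blast
    define G where "G = \<lparr> verts = {0..<m}, edges = {e. e \<subseteq> {0..<m} \<and> card e = r \<and> f ` e \<in> edges H} \<rparr>"
    have G: "r_graph r G" "card (verts G) = m" unfolding G_def r_graph_def by auto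
    have "family_free ?F G"
      unfolding free_iff_no_tight_cycle_hom[OF G(1)]
    proof clarify
      fix l \<phi> assume l: "l > r" "[l = k] (mod r)"
      and hom: "hypergraph_hom \<phi> (tight_cycle r l) G"
      have "hypergraph_hom (f \<circ> \<phi>) (tight_cycle r l) H"
        using hom f(2) unfolding hypergraph_hom_def image_comp[symmetric] G_def by auto
      thus False using H(3) l unfolding free_iff_no_tight_cycle_hom[OF H(1)] by blast
    qed
    hence le: "min_codegree r G \<le> codegree_ex r m ?F" using codegree_ex_attained(2)[OF r m G]
      by blast
    \<comment> \<open>Codegrees are natural numbers, so the real lower bound is rounded up before
      taking the minimum.\<close>
    have "nat \<lceil>(real \<delta> / real n - \<epsilon>) * real m\<rceil> \<le> min_codegree r G"
    proof (rule min_codegree_nbrs(2)[OF G(1) r])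
      fix S assume "S \<subseteq> verts G" and cS: "card S = r - 1"
      hence S: "S \<subseteq> {0..<m}" unfolding G_def by simp
      have fS: "finite S" using S finite_subset by blast
      have "{j \<in> {0..<m} - S. f j \<in> nbrs (edges H) (f ` S)} \<subseteq> nbrs (edges G) S"
        using S cS fS r unfolding nbrs_def G_def by auto
      moreover have "nbrs (edges G) S \<subseteq> {0..<m}" unfolding nbrs_def G_def by auto
      hence "finite (nbrs (edges G) S)" using finite_subset by blast
      ultimately have "card {j \<in> {0..<m} - S. f j \<in> nbrs (edges H) (f ` S)} \<le> card (nbrs (edges G) S)"
        by (rule card_mono[rotated])
      thus "nat \<lceil>(real \<delta> / real n - \<epsilon>) * real m\<rceil> \<le> card (nbrs (edges G) S)"
        using f(3)[OF S cS] by linarith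
    qed (use G m in simp)
    hence "(real \<delta> / real n - \<epsilon>) * real m \<le> real (codegree_ex r m ?F)" using le
      by linarith
    thus ?thesis unfolding ra using m0 by (simp add: codegree_ratio_def pos_le_divide_eq)
  qed
qed

text \<open>Letting \<open>n\<close> grow for fixed large \<open>m\<close> gives
  \<open>limsup a - \<epsilon> \<le> a m\<close>, hence
  \<open>limsup a - \<epsilon> \<le> liminf a\<close>. Bounds are required from \<open>b\<close> on
  only, as extremal numbers for few vertices can be unspecified.\<close>

lemma convergent_of_almost_decreasing:
  fixes a :: "nat \<Rightarrow> real"
  assumes bd: "\<And>n. n \<ge> b \<Longrightarrow> 0 \<le> a n \<and> a n \<le> 1"
    and dec: "\<And>\<epsilon>. \<epsilon> > 0 \<Longrightarrow> \<exists>M. \<forall>m\<ge>M. \<exists>N. \<forall>n\<ge>N. a n - \<epsilon> \<le> a m"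
  shows "convergent a"
proof -
  define L where "L = limsup (\<lambda>n. ereal (a n))"
  have ev: "\<forall>\<^sub>F n in sequentially. 0 \<le> a n \<and> a n \<le> 1"
    using bd eventually_sequentially by blast
  have "L \<le> 1" unfolding L_def
    by (rule Limsup_bounded) (use ev in \<open>auto elim: eventually_mono\<close>)
  moreover have "0 \<le> L" unfolding L_def
    by (rule le_Limsup) (use ev in \<open>auto elim: eventually_mono\<close>)
  ultimately obtain l where l: "L = ereal l" by (cases L) auto
  have "liminf (\<lambda>n. ereal (a n)) \<ge> L"
  proof (rule ereal_le_epsilon2)
    fix \<epsilon> :: real assume e: "\<epsilon> > 0"
    obtain M where M: "\<And>m. m \<ge> M \<Longrightarrow> \<exists>N. \<forall>n\<ge>N. a n - \<epsilon> \<le> a m" using dec[OF e] by blast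
    have "L - ereal \<epsilon> \<le> ereal (a m)" if "m \<ge> M" for m
    proof -
      obtain N where "\<forall>n\<ge>N. a n - \<epsilon> \<le> a m"
        using M[OF \<open>m \<ge> M\<close>] by blast
      hence "L \<le> ereal (a m + \<epsilon>)"
        unfolding L_def
        by (intro Limsup_bounded) (auto simp: eventually_sequentially intro!: exI[of _ N])
      thus ?thesis using l by simp
    qed
    hence "L - ereal \<epsilon> \<le> liminf (\<lambda>n. ereal (a n))"
      by (intro Liminf_bounded) (auto simp: eventually_sequentially)
    thus "L \<le> liminf (\<lambda>n. ereal (a n)) + ereal \<epsilon>" by (simp add: ereal_minus_le)
  qed
  hence "(\<lambda>n. ereal (a n)) \<longlonglongrightarrow> ereal l"
    using l Liminf_le_Limsup[of sequentially "\<lambda>n. ereal (a n)"]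
    by (intro Liminf_eq_Limsup) (auto simp: L_def)
  thus ?thesis unfolding convergent_def by auto
qed

lemma convergent_codegree_ratio:
  assumes r: "r > 0"
  shows "convergent (codegree_ratio r (hom_family r (tight_cycle_family r k)))"
proof (rule convergent_of_almost_decreasing[where b = r])
  let ?F = "hom_family r (tight_cycle_family r k)"
  fix n assume n: "n \<ge> r"
  obtain H :: "nat hypergraph" where H: "r_graph r H" "card (verts H) = n"
    and Hm: "min_codegree r H = codegree_ex r n ?F" using codegree_ex_attained(1)[OF r n] by blast
  have "codegree_ex r n ?F \<le> n" using min_codegree_nbrs(3)[OF H(1) r] H Hm n by simp
  thus "0 \<le> codegree_ratio r ?F n \<and> codegree_ratio r ?F n \<le> 1"
    unfolding codegree_ratio_def using r n by simp
next
  let ?F = "hom_family r (tight_cycle_family r k)"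
  fix \<epsilon> :: real assume e: "\<epsilon> > 0"
  \<comment> \<open>Exponential decay beats the number of \<open>(r - 1)\<close>-sets, which is
    polynomial in \<open>m\<close>.\<close>
  have "((\<lambda>m. real m ^ (r - 1) * exp (real (r - 1) - \<epsilon>\<^sup>2 / 8 * real m)) \<longlongrightarrow> 0) sequentially"
    using e by real_asymp
  hence "\<forall>\<^sub>F m in sequentially. real m ^ (r - 1) * exp (real (r - 1) - \<epsilon>\<^sup>2 / 8 * real m) < 1 / 2"
    by (rule order_tendstoD) simp
  then obtain M where M: "\<And>m. m \<ge> M \<Longrightarrow> real m ^ (r - 1) * exp (real (r - 1) - \<epsilon>\<^sup>2 / 8 * real m) < 1 / 2"
    unfolding eventually_sequentially by blast
  show "\<exists>M. \<forall>m\<ge>M. \<exists>N. \<forall>n\<ge>N. codegree_ratio r ?F n - \<epsilon> \<le> codegree_ratio r ?F m"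
  proof (intro exI allI impI)
    fix m n assume "m \<ge> max M r" "n \<ge> r + 2 * m ^ 2 + 1"
    thus "codegree_ratio r ?F n - \<epsilon> \<le> codegree_ratio r ?F m"
      using M[of m] e by (intro codegree_ratio_almost_decreasing r) auto
  qed
qed

subsection \<open>Availability of Young subgroups\<close>

definition rot :: "nat \<Rightarrow> nat \<Rightarrow> nat \<Rightarrow> nat" where
  "rot r k = cyc r [^]\<^bsub>sym_group r\<^esub> k"

lemma rot_eq_funpow: "rot r k = cyc r ^^ k"
  unfolding rot_def
  by (induction k) (simp_all add: sym_group_mult sym_group_one funpow_Suc_right del: funpow.simps(2))

lemma rot_permutes: "rot r k permutes {1..r}"
proof -
  have "cyc r permutes {1..r}"
    using cycle_permutes[of "[1..<Suc r]"] unfolding cyc_def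
    by (simp add: atLeastLessThanSuc_atLeastAtMost del: upt_Suc)
  thus ?thesis unfolding rot_eq_funpow
    by (induction k) (auto simp: permutes_id intro: permutes_compose)
qed

text \<open>The permuted points are \<open>1..r\<close>, so position \<open>j\<close> counted from
  \<open>0\<close> is the point \<open>Suc j\<close>; in positions \<open>rot r k\<close> is
  addition of \<open>k\<close> modulo \<open>r\<close>.\<close>

lemma rot_Suc:
  assumes "j < r"
  shows "rot r k (Suc j) = Suc ((j + k) mod r)"
proof -
  let ?c = "[1..<Suc r]"
  have "map (rot r k) ?c = rotate k ?c"
    unfolding rot_eq_funpow cyc_def by (rule cyclic_rotation) simp
  hence "map (rot r k) ?c ! j = rotate k ?c ! j" by simp
  moreover have "(k + j) mod r < r" using assms by simp
  ultimately show ?thesis using assms by (simp add: nth_rotate add.commute del: upt_Suc)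
qed

text \<open>The indicator of an invariant set has periods \<open>r\<close> and \<open>k\<close>,
  hence \<open>gcd r k\<close>, so the set has the same number of points in each of the
  \<open>r div gcd r k\<close> periods.\<close>

lemma rot_invariant_card:
  assumes r: "r > 0" and P: "P \<subseteq> {1..r}" "rot r k ` P = P"
  shows "r div gcd r k dvd card P"
proof -
  define g where "g = gcd r k"
  define f :: "nat \<Rightarrow> nat" where "f j = of_bool (Suc (j mod r) \<in> P)" for j
  have inj: "inj (rot r k)" using rot_permutes permutes_inj by blast
  have fr: "f (j + r) = f j" for j unfolding f_def by simp
  have fk: "f (j + k) = f j" for j
  proof -
    have "Suc ((j + k) mod r) = rot r k (Suc (j mod r))" using r
      by (simp add: rot_Suc mod_add_left_eq)
    thus ?thesis using P(2) inj_image_mem_iff[OF inj, of "Suc (j mod r)" P] unfolding f_def by simp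
  qed
  obtain a b where ab: "r * a = k * b + g" using bezout_nat[of r k] r unfolding g_def by auto
  have fg: "f (j + g) = f j" for j
  proof -
    have "f (j + g) = f (j + g + b * k)" using periodic_mult[of f k, OF fk] by simp
    also have "\<dots> = f (j + a * r)" using ab by (simp add: algebra_simps)
    finally show ?thesis using periodic_mult[of f r, OF fr] by simp
  qed
  have "P = Suc ` {j \<in> {..<r}. Suc j \<in> P}"
  proof
    show "P \<subseteq> Suc ` {j \<in> {..<r}. Suc j \<in> P}"
    proof
      fix x assume x: "x \<in> P"
      hence "x \<ge> 1" "x \<le> r" using P by auto
      thus "x \<in> Suc ` {j \<in> {..<r}. Suc j \<in> P}" using x
        by (intro image_eqI[of _ _ "x - 1"]) auto
    qed
  qed auto
  hence "card P = card {j \<in> {..<r}. Suc j \<in> P}" by (metis card_image inj_Suc)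
  also have "\<dots> = (\<Sum>j<r. f j)" unfolding f_def
    by (simp add: sum.If_cases of_bool_def Int_def)
  also have "\<dots> = (\<Sum>j<(r div g) * g. f j)" unfolding g_def by simp
  also have "\<dots> = (r div g) * (\<Sum>j<g. f j)" by (rule periodic_sum[of f g, OF fg])
  finally show ?thesis unfolding g_def by simp
qed

lemma permutes_mapping_subset:
  assumes A: "finite A" "P \<subseteq> A" "Q \<subseteq> A" "card P = card Q"
  shows "\<exists>h. h permutes A \<and> h ` P = Q"
proof -
  have fin: "finite P" "finite Q" using A finite_subset by auto
  obtain h1 where h1: "bij_betw h1 P Q" using finite_same_card_bij[OF fin A(4)] by blast
  have "card (A - P) = card (A - Q)" using A fin by (simp add: card_Diff_subset)
  then obtain h2 where h2: "bij_betw h2 (A - P) (A - Q)"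
    using finite_same_card_bij[of "A - P" "A - Q"] A by auto
  define h where "h x = (if x \<in> P then h1 x else if x \<in> A then h2 x else x)" for x
  have b1: "bij_betw h P Q" by (rule bij_betw_cong[THEN iffD1, OF _ h1]) (simp add: h_def)
  have b2: "bij_betw h (A - P) (A - Q)"
    by (rule bij_betw_cong[THEN iffD1, OF _ h2]) (simp add: h_def)
  have "bij_betw h A A" using bij_betw_combine[OF b1 b2] A by (simp add: Un_absorb1)
  hence "h permutes A" by (rule bij_imp_permutes) (use A in \<open>auto simp: h_def\<close>)
  thus ?thesis using b1 unfolding bij_betw_def by blast
qed

lemma conjugate_avoiding_iff:
  "conjugate_avoiding r x H \<longleftrightarrow> subgroup H (sym_group r) \<and> (\<forall>g. g permutes {1..r} \<longrightarrow> g \<circ> x \<circ> inv' g \<notin> H)"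
  unfolding conjugate_avoiding_def
  by (auto simp: sym_group_carrier sym_group_mult sym_group_inv_equality)

lemma young_subgroup_iff:
  assumes i: "i \<le> r"
  shows "p \<in> young_subgroup r i \<longleftrightarrow> p permutes {1..r} \<and> p ` {1..i} = {1..i}"
proof -
  have "p ` {Suc i..r} = {Suc i..r}" if p: "p permutes {1..r}" "p ` {1..i} = {1..i}"
  proof -
    have s: "{Suc i..r} = {1..r} - {1..i}" using i by auto
    show ?thesis unfolding s
      using image_set_diff[OF permutes_inj[OF p(1)], of "{1..r}" "{1..i}"] permutes_image[OF p(1)] p(2) by simp
  qed
  thus ?thesis unfolding young_subgroup_def by (auto simp: sym_group_carrier)
qed

lemma subgroup_young:
  assumes i: "i \<le> r"
  shows "subgroup (young_subgroup r i) (sym_group r)"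
proof (rule group.subgroupI[OF sym_group_is_group])
  show "young_subgroup r i \<subseteq> carrier (sym_group r)" unfolding young_subgroup_def by auto
  have "id \<in> young_subgroup r i" unfolding young_subgroup_iff[OF i] by (simp add: permutes_id)
  thus "young_subgroup r i \<noteq> {}" by blast
  show "inv\<^bsub>sym_group r\<^esub> p \<in> young_subgroup r i" if "p \<in> young_subgroup r i"
    for p
  proof -
    have p: "p permutes {1..r}" "p ` {1..i} = {1..i}" using that unfolding young_subgroup_iff[OF i]
      by auto
    have "inv' p ` {1..i} = {1..i}" using p(2) image_inv_f_f[OF permutes_inj[OF p(1)]] by metis
    thus ?thesis using permutes_inv[OF p(1)] p(1) unfolding young_subgroup_iff[OF i]
      by (simp add: sym_group_carrier)
  qed
  show "p \<otimes>\<^bsub>sym_group r\<^esub> q \<in> young_subgroup r i"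
    if "p \<in> young_subgroup r i" "q \<in> young_subgroup r i" for p q
    using that unfolding young_subgroup_iff[OF i] sym_group_mult
    by (metis image_comp permutes_compose)
qed

lemma conj_image:
  assumes "h permutes A"
  shows "(h \<circ> p \<circ> inv' h) ` (h ` P) = h ` (p ` P)"
  using permutes_inverses(2)[OF assms] by (simp add: image_image)

text \<open>The \<open>d\<close> points congruent to \<open>1\<close> modulo \<open>g\<close> are
  invariant under \<open>cyc^k\<close>. Relabelling them as \<open>1..d\<close> conjugates
  \<open>cyc^k\<close> into the Young subgroup.\<close>

lemma not_available:
  assumes r: "r > 0" and d: "d = r div gcd r k"
  shows "\<not> available r k d"
proof
  define g where "g = gcd r k"
  have g: "g > 0" "g dvd r" "g dvd k" unfolding g_def using r by auto
  have rd: "r = d * g" unfolding d g_def by simp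
  have dr: "d \<le> r" unfolding d by simp
  define P where "P = {x \<in> {1..r}. (x - 1) mod g = 0}"
  have Psub: "P \<subseteq> {1..r}" unfolding P_def by auto
  have finP: "finite P" unfolding P_def by auto
  have "bij_betw (\<lambda>j. Suc (j * g)) {0..<d} P"
  proof (rule bij_betwI[where g = "\<lambda>x. (x - 1) div g"])
    show "(\<lambda>j. Suc (j * g)) \<in> {0..<d} \<rightarrow> P"
      unfolding P_def rd using g by (auto simp: Suc_le_eq)
    show "(\<lambda>x. (x - 1) div g) \<in> P \<rightarrow> {0..<d}"
      unfolding P_def rd using g by (auto intro!: less_mult_imp_div_less)
    show "Suc ((x - 1) div g * g) = x" if "x \<in> P" for x
      using that unfolding P_def by auto
  qed (use g in auto)
  hence cP: "card P = d" using bij_betw_same_card by fastforce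
  have "rot r k ` P \<subseteq> P"
  proof clarify
    fix x assume x: "x \<in> P"
    then obtain j where j: "x = Suc j" "j < r" "j mod g = 0"
      unfolding P_def by (cases x) auto
    have "(j + k) mod r mod g = 0" using g j by (simp add: mod_mod_cancel mod_eq_0_iff_dvd)
    thus "rot r k x \<in> P" using j rot_Suc[OF j(2), of k] r unfolding P_def
      by (auto simp: Suc_le_eq)
  qed
  moreover have "inj (rot r k)" using rot_permutes permutes_inj by blast
  ultimately have CP: "rot r k ` P = P" using endo_inj_surj[OF finP] inj_on_subset by blast
  obtain h where h: "h permutes {1..r}" "h ` P = {1..d}"
    using permutes_mapping_subset[of "{1..r}" P "{1..d}"] Psub cP dr by auto
  have hy: "h \<circ> rot r k \<circ> inv' h \<in> young_subgroup r d"
    unfolding young_subgroup_iff[OF dr]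
    using conj_image[OF h(1), of "rot r k" P] CP h permutes_compose[OF permutes_compose[OF permutes_inv[OF h(1)] rot_permutes] h(1)]
    by (simp add: comp_assoc)
  assume "available r k d"
  then obtain q where q: "q permutes {1..r}"
    and av: "conjugate_avoiding r (rot r k)
      (q <#\<^bsub>sym_group r\<^esub> young_subgroup r d #>\<^bsub>sym_group r\<^esub> inv\<^bsub>sym_group r\<^esub> q)"
    unfolding available_def maximal_conjugate_avoiding_def rot_def by (auto simp: sym_group_carrier)
  \<comment> \<open>Availability refers to a conjugate of the Young subgroup by \<open>q\<close>, so
    the offending element is conjugated once more.\<close>
  have "q \<circ> (h \<circ> rot r k \<circ> inv' h) \<circ> inv' q \<in> q <#\<^bsub>sym_group r\<^esub> young_subgroup r d #>\<^bsub>sym_group r\<^esub> inv\<^bsub>sym_group r\<^esub> q"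
    using hy q unfolding l_coset_def r_coset_def by (auto simp: sym_group_mult sym_group_carrier)
  moreover have "q \<circ> (h \<circ> rot r k \<circ> inv' h) \<circ> inv' q = (q \<circ> h) \<circ> rot r k \<circ> inv' (q \<circ> h)"
    using o_inv_distrib[OF permutes_bij[OF q] permutes_bij[OF h(1)]] by (simp add: comp_assoc)
  ultimately show False using av permutes_compose[OF h(1) q] unfolding conjugate_avoiding_iff
    by metis
qed

lemma subgroup_sym_closed:
  assumes K: "subgroup K (sym_group r)"
  shows "p \<in> K \<Longrightarrow> p permutes {1..r}" "p \<in> K \<Longrightarrow> q \<in> K \<Longrightarrow> p \<circ> q \<in> K" "p \<in> K \<Longrightarrow> inv' p \<in> K" "id \<in> K"
proof -
  show 1: "p permutes {1..r}" if "p \<in> K" for p using subgroup.mem_carrier[OF K that]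
    by (simp add: sym_group_carrier)
  show "p \<circ> q \<in> K" if "p \<in> K" "q \<in> K" using subgroup.m_closed[OF K that]
    by (simp add: sym_group_mult)
  show "inv' p \<in> K" if "p \<in> K"
    using subgroup.m_inv_closed[OF K that] 1[OF that] by (simp add: sym_group_carrier)
  show "id \<in> K" using subgroup.one_closed[OF K] by (simp add: sym_group_one)
qed

lemma transpose_conj:
  assumes "bij p"
  shows "p \<circ> transpose a b \<circ> inv' p = transpose (p a) (p b)"
proof
  fix x
  obtain y where y: "x = p y" using assms by (metis bij_pointE)
  have "inv' p (p y) = y" using assms by (simp add: bij_is_inj)
  thus "(p \<circ> transpose a b \<circ> inv' p) x = transpose (p a) (p b) x"
    unfolding y using assms by (auto simp: transpose_def bij_def inj_eq)
qed

text \<open>A conjugate of \<open>cyc^k\<close> in the subgroup would have an invariant set of odd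
  size \<open>i\<close>, but such sizes are multiples of the even \<open>d\<close>. For maximality,
  an element \<open>p\<close> of a larger avoiding \<open>K\<close> must exchange \<open>A\<close>
  and \<open>B\<close>; a conjugate of \<open>cyc^k\<close> exchanges them too, and differs from
  \<open>p\<close> by an element of the Young subgroup.\<close>

lemma available_odd:
  assumes r: "r > 0" and d: "even (r div gcd r k)" and i: "odd i" "i \<le> r"
  shows "available r k i"
proof -
  define Y where "Y = young_subgroup r i"
  define A where "A = {1..i}"
  define B where "B = {1..r} - A"
  have AB: "A \<subseteq> {1..r}" "B \<subseteq> {1..r}" "finite A" "finite B" "card A = i" "A \<union> B = {1..r}" "A \<inter> B = {}"
    unfolding A_def B_def using i by auto
  have Yiff: "p \<in> Y \<longleftrightarrow> p permutes {1..r} \<and> p ` A = A" for p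
    unfolding Y_def A_def by (rule young_subgroup_iff[OF i(2)])
  have sub: "subgroup Y (sym_group r)" unfolding Y_def by (rule subgroup_young[OF i(2)])
  have avoid: "g \<circ> rot r k \<circ> inv' g \<notin> Y" if g: "g permutes {1..r}" for g
  proof
    assume y: "g \<circ> rot r k \<circ> inv' g \<in> Y"
    define P where "P = inv' g ` A"
    have gP: "g ` P = A" unfolding P_def using permutes_inv_o(1)[OF g] by (simp add: image_comp)
    have "g ` (rot r k ` P) = g ` P" using y conj_image[OF g, of "rot r k" P] unfolding Yiff gP
      by simp
    hence "rot r k ` P = P" using permutes_inj[OF g] by (simp add: inj_image_eq_iff)
    moreover have "P \<subseteq> {1..r}" unfolding P_def
      using permutes_image[OF permutes_inv[OF g]] AB(1) by blast
    ultimately have "r div gcd r k dvd card P" by (intro rot_invariant_card[OF r])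
    moreover have "card P = i" using gP AB(5) card_image[OF inj_on_subset[OF permutes_inj[OF g]]]
      by (metis subset_UNIV)
    ultimately show False using d i dvd_trans by blast
  qed
  have maximal: "K = Y" if K: "subgroup K (sym_group r)" "Y \<subseteq> K"
    and Kav: "\<And>g. g permutes {1..r} \<Longrightarrow> g \<circ> rot r k \<circ> inv' g \<notin> K" for K
  proof (rule ccontr)
    assume "K \<noteq> Y"
    then obtain p where p: "p \<in> K" "p \<notin> Y" using K by blast
    note Kc = subgroup_sym_closed[OF K(1)]
    have pp: "p permutes {1..r}" using Kc(1) p by blast
    have bp: "bij p" using pp permutes_bij by blast
    have pim: "p x \<in> A \<union> B" if "x \<in> A \<union> B" for x
      using that permutes_in_image[OF pp] AB(6) by blast
    have pA: "p ` A \<noteq> A" using p(2) pp unfolding Yiff by blast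
    have pinj: "inj_on p S" for S using permutes_inj[OF pp] by (rule inj_on_subset) simp
    have notA: "\<not> p ` A \<subseteq> A" using pA endo_inj_surj[OF AB(3) _ pinj] by blast
    then obtain a where a: "a \<in> A" "p a \<in> B" using pim by blast
    have "\<not> p ` B \<subseteq> B"
    proof
      assume "p ` B \<subseteq> B"
      hence "p ` B = B" using endo_inj_surj[OF AB(4) _ pinj] by blast
      moreover have "A = {1..r} - B" unfolding B_def using AB(1) by blast
      ultimately have "p ` A = A"
        using image_set_diff[OF permutes_inj[OF pp], of "{1..r}" B] permutes_image[OF pp] by simp
      thus False using pA by simp
    qed
    then obtain b where b: "b \<in> B" "p b \<in> A" using pim by blast
    have YA: "transpose x y \<in> K"
      if "x \<in> A \<and> y \<in> A \<or> x \<in> B \<and> y \<in> B" for x y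
    proof -
      have "transpose x y permutes {1..r}" using that AB by (intro permutes_swap_id) auto
      moreover have "transpose x y ` A = A"
        using that AB(7) by (intro endo_inj_surj[OF AB(3)]) (auto simp: transpose_def)
      ultimately show ?thesis using K(2) Yiff[of "transpose x y"] by blast
    qed
    \<comment> \<open>One transposition between \<open>A\<close> and \<open>B\<close>, together with
      those inside \<open>A\<close> and inside \<open>B\<close>, generates the whole symmetric
      group, which contains \<open>cyc^k\<close>.\<close>
    have no_cross: False if x: "x \<in> A" "y \<in> B" and xy: "transpose x y \<in> K" for x y
    proof -
      have tr: "transpose u w \<in> K"
        if "transpose u v \<in> K" "transpose v w \<in> K" "distinct [u, v, w]" for u v w :: nat
      proof -
        have "transpose u w = transpose u v \<circ> transpose v w \<circ> transpose u v"
          using that(3) by (auto simp: fun_eq_iff transpose_def)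
        thus ?thesis using Kc(2) that by metis
      qed
      have cross: "transpose u w \<in> K" if uw: "u \<in> A" "w \<in> B" for u w
      proof -
        have 1: "transpose u y \<in> K"
          using tr[of u x y] YA[of u x] uw x xy AB(7) by (cases "u = x") auto
        thus ?thesis using tr[of u y w] YA[of y w] uw x AB(7) by (cases "y = w") auto
      qed
      have all: "transpose u w \<in> K" if "u \<in> {1..r}" "w \<in> {1..r}" for u w
        using that cross[of u w] cross[of w u] YA[of u w] AB(6) transpose_commute[of u w]
        by (metis UnE)
      have "rot r k \<in> K"
        using rot_permutes[of r k] finite_atLeastAtMost
      proof (induction rule: permutes_induct)
        case id thus ?case using Kc(4) .
      next
        case (swap a b p) thus ?case using all Kc(2) by blast
      qed
      thus False using Kav[OF permutes_id] by simp
    qed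
    have ctr: "transpose (p x) (p y) \<in> K" if "transpose x y \<in> K" for x y
      using transpose_conj[OF bp, of x y] Kc(2,3) p(1) that by metis
    \<comment> \<open>If \<open>p\<close> kept some \<open>x\<close> in \<open>A\<close> while
      moving \<open>a\<close> to \<open>B\<close>, conjugating \<open>transpose x a\<close> by
      \<open>p\<close> would give a transposition between \<open>A\<close> and
      \<open>B\<close>.\<close>
    have A': "p x \<in> B" if "x \<in> A" for x
    proof (rule ccontr)
      assume "p x \<notin> B"
      hence "p x \<in> A" using pim that by blast
      thus False using no_cross[of "p x" "p a"] a ctr[OF YA[of x a]] that by blast
    qed
    have B': "p x \<in> A" if "x \<in> B" for x
    proof (rule ccontr)
      assume "p x \<notin> A"
      hence "p x \<in> B" using pim that by blast
      thus False using no_cross[of "p b" "p x"] b ctr[OF YA[of b x]] that by blast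
    qed
    have "card A \<le> card B" using A' AB pinj by (intro card_inj_on_le[of p]) auto
    moreover have "card B \<le> card A" using B' AB pinj by (intro card_inj_on_le[of p]) auto
    moreover have "card A + card B = r" using AB
      by (metis card_Un_disjoint card_atLeastAtMost diff_Suc_1)
    ultimately have r2: "r = 2 * i" using AB by linarith
    define g where "g = gcd r k"
    define c where "c = r div g"
    define k' where "k' = k div g"
    have g: "g > 0" "r = g * c" "k = g * k'" unfolding g_def c_def k'_def using r by auto
    have "coprime c k'" unfolding c_def k'_def g_def using r by (intro div_gcd_coprime) auto
    hence k'o: "odd k'" and ce: "even c" using d unfolding c_def g_def
      by (auto dest: coprime_common_divisor[of _ _ 2])
    \<comment> \<open>Blocks of \<open>g\<close> consecutive points, taken alternately. Since
      \<open>k div g\<close> is odd and the number \<open>c\<close> of blocks is even,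
      \<open>cyc^k\<close> interchanges \<open>P\<close> and its complement.\<close>
    define P where "P = {x \<in> {1..r}. even ((x - 1) div g)}"
    define Q where "Q = {1..r} - P"
    have par: "even ((rot r k x - 1) div g) \<longleftrightarrow> odd ((x - 1) div g)"
      if x: "x \<in> {1..r}" for x
    proof -
      obtain j where j: "x = Suc j" "j < r" using x by (cases x) auto
      have "(j + k) div g = j div g + k'" using g by simp
      moreover have "(j + k) mod r div g = (j + k) div g mod c" unfolding g(2) using g(1)
        by (simp add: mod_mult2_eq)
      moreover have "even (y mod c) \<longleftrightarrow> even y" for y using ce
        by (simp add: dvd_mod_iff)
      ultimately show ?thesis using j rot_Suc[OF j(2), of k] k'o by simp
    qed
    have rim: "rot r k x \<in> {1..r}" if "x \<in> {1..r}" for x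
      using that permutes_in_image[OF rot_permutes] by blast
    have PQ: "rot r k ` P \<subseteq> Q" "rot r k ` Q \<subseteq> P" using par rim
      unfolding P_def Q_def by auto
    have rinj: "inj_on (rot r k) S" for S using permutes_inj[OF rot_permutes]
      by (rule inj_on_subset) simp
    have finPQ: "finite P" "finite Q" "P \<subseteq> {1..r}" unfolding P_def Q_def by auto
    have "card P \<le> card Q" "card Q \<le> card P"
      using card_inj_on_le[OF rinj PQ(1)] card_inj_on_le[OF rinj PQ(2)] finPQ by auto
    moreover have "card Q = r - card P" "card P \<le> r"
      unfolding Q_def using finPQ card_mono[of "{1..r}" P] by (auto simp: card_Diff_subset)
    ultimately have cP: "card P = card A" using r2 AB by linarith
    obtain h where h: "h permutes {1..r}" "h ` P = A"
      using permutes_mapping_subset[OF _ finPQ(3) AB(1) cP] by auto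
    have hQ: "h ` Q = B"
      unfolding Q_def B_def
      using image_set_diff[OF permutes_inj[OF h(1)], of "{1..r}" P] permutes_image[OF h(1)] h(2)
      by simp
    define q where "q = h \<circ> rot r k \<circ> inv' h"
    have qp: "q permutes {1..r}" unfolding q_def comp_assoc
      by (intro permutes_compose permutes_inv h rot_permutes)
    have "q ` A = h ` (rot r k ` P)" unfolding q_def using conj_image[OF h(1), of "rot r k" P] h
      by simp
    hence qA: "q ` A \<subseteq> B" using PQ(1) hQ by blast
    have ipB: "inv' p y \<in> A" if y: "y \<in> B" for y
    proof -
      have e: "p (inv' p y) = y" using bp by (simp add: bij_is_surj surj_f_inv_f)
      have "inv' p y \<in> {1..r}" using y AB(2) permutes_in_image[OF permutes_inv[OF pp]] by blast
      hence "inv' p y \<in> A \<union> B" using AB(6) by simp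
      thus ?thesis using B'[of "inv' p y"] e y AB(7) by auto
    qed
    \<comment> \<open>\<open>q\<close> sends \<open>A\<close> into \<open>B\<close> and the inverse
      of \<open>p\<close> sends \<open>B\<close> back into \<open>A\<close>, so their composition
      lies in the Young subgroup and \<open>q\<close> lies in \<open>K\<close>.\<close>
    have s: "inv' p \<circ> q permutes {1..r}" by (intro permutes_compose qp permutes_inv pp)
    have "(inv' p \<circ> q) ` A \<subseteq> A" using qA ipB by auto
    hence "(inv' p \<circ> q) ` A = A"
      using endo_inj_surj[OF AB(3)] inj_on_subset[OF permutes_inj[OF s]] by blast
    hence "inv' p \<circ> q \<in> K" using s K(2) Yiff[of "inv' p \<circ> q"] by blast
    hence "p \<circ> (inv' p \<circ> q) \<in> K" using Kc(2) p(1) by blast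
    moreover have "p \<circ> (inv' p \<circ> q) = q" using permutes_inv_o(1)[OF pp]
      by (simp add: comp_assoc[symmetric])
    ultimately show False using Kav[OF h(1)] unfolding q_def by simp
  qed
  have idY: "id <#\<^bsub>sym_group r\<^esub> Y #>\<^bsub>sym_group r\<^esub> inv\<^bsub>sym_group r\<^esub> id = Y"
    unfolding l_coset_def r_coset_def by (simp add: sym_group_mult sym_group_carrier permutes_id)
  have "maximal_conjugate_avoiding r (rot r k) Y"
    unfolding maximal_conjugate_avoiding_def conjugate_avoiding_iff using sub avoid maximal by blast
  thus ?thesis unfolding available_def rot_def[symmetric] Y_def[symmetric]
    using idY by (intro bexI[of _ id]) (auto simp: sym_group_carrier permutes_id)
qed

lemma all_odd_available_iff:
  assumes r: "r > 0"
  shows "even r \<and> (\<forall>i\<in>{1..r - 1}. odd i \<longrightarrow> available r k i) \<longleftrightarrow> even (r div gcd r k)"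
proof
  assume av: "even r \<and> (\<forall>i\<in>{1..r - 1}. odd i \<longrightarrow> available r k i)"
  show "even (r div gcd r k)"
  proof (rule ccontr)
    assume o: "odd (r div gcd r k)"
    hence "r div gcd r k \<noteq> r" using av by auto
    moreover have "r div gcd r k \<le> r" by simp
    moreover have "r div gcd r k \<noteq> 0" using o by (metis even_zero)
    ultimately have "r div gcd r k \<in> {1..r - 1}" unfolding atLeastAtMost_iff by linarith
    thus False using av o not_available[OF r refl] by blast
  qed
next
  assume ev: "even (r div gcd r k)"
  have "r div gcd r k dvd r" using dvd_triv_left[of "r div gcd r k" "gcd r k"] by simp
  hence "even r" using ev dvd_trans by blast
  thus "even r \<and> (\<forall>i\<in>{1..r - 1}. odd i \<longrightarrow> available r k i)"
    using available_odd[OF r ev] by auto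
qed

section \<open>From codegree thresholds to the codegree density\<close>

lemma codegree_ex_bound:
  assumes r: "r > 0" and n: "n \<ge> r"
    and dense: "\<And>H :: nat hypergraph. r_graph r H \<Longrightarrow> r \<le> card (verts H) \<Longrightarrow>
      (\<And>S. S \<subseteq> verts H \<Longrightarrow> card S = r - 1 \<Longrightarrow> card (verts H) < c * card (nbrs (edges H) S)) \<Longrightarrow>
      \<not> family_free (hom_family r (tight_cycle_family r k)) H"
  shows "c * codegree_ex r n (hom_family r (tight_cycle_family r k)) \<le> n"
proof (rule ccontr)
  let ?F = "hom_family r (tight_cycle_family r k)"
  assume less: "\<not> c * codegree_ex r n ?F \<le> n"
  obtain H :: "nat hypergraph" where H: "r_graph r H" "card (verts H) = n" "family_free ?F H"
    and Hm: "min_codegree r H = codegree_ex r n ?F" using codegree_ex_attained(1)[OF r n] by blast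
  have "card (verts H) < c * card (nbrs (edges H) S)" if "S \<subseteq> verts H" "card S = r - 1"
    for S
  proof -
    have "min_codegree r H \<le> card (nbrs (edges H) S)"
      using min_codegree_nbrs(1)[OF H(1) r _ that] H(2) n by simp
    hence "c * codegree_ex r n ?F \<le> c * card (nbrs (edges H) S)" unfolding Hm by simp
    thus ?thesis using less H(2) by linarith
  qed
  thus False using dense[OF H(1)] H(2,3) n by blast
qed

theorem theorem11:
  fixes r k :: nat
  assumes "r \<ge> 2" and "\<not> [k = 0] (mod r)"
  shows "convergent (codegree_ratio r (hom_family r (tight_cycle_family r k))) \<and>
    (if even r \<and> (\<forall>i\<in>{1..r - 1}. odd i \<longrightarrow> available r k i)
     then codegree_density r (hom_family r (tight_cycle_family r k)) = 1 / 2
     else codegree_density r (hom_family r (tight_cycle_family r k)) \<le> 1 / 3)"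
proof -
  let ?F = "hom_family r (tight_cycle_family r k)"
  have r: "r > 0" using assms by simp
  have conv: "convergent (codegree_ratio r ?F)" by (rule convergent_codegree_ratio[OF r])
  have lim: "codegree_ratio r ?F \<longlonglongrightarrow> codegree_density r ?F"
    using conv unfolding codegree_density_def convergent_LIMSEQ_iff .
  have half: "codegree_density r ?F = 1 / 2" if d: "even (r div gcd r k)"
  proof -
    have "codegree_ratio r ?F \<longlonglongrightarrow> 1 / 2"
    proof (rule tendsto_sandwich)
      \<comment> \<open>The error term collects the loss of \<open>r\<close> in the parity
        construction and the rounding in \<open>n div 2\<close>.\<close>
      show "\<forall>\<^sub>F n in sequentially. 1 / 2 - (real r + 1) / real n \<le> codegree_ratio r ?F n"
        unfolding eventually_sequentially
      proof (intro exI allI impI)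
        fix n assume n: "r \<le> n"
        have "n div 2 - r \<le> codegree_ex r n ?F" by (rule codegree_ex_lower[OF r n d])
        hence "real n / 2 - (real r + 1) \<le> real (codegree_ex r n ?F)" by linarith
        hence "(real n / 2 - (real r + 1)) / real n \<le> real (codegree_ex r n ?F) / real n"
          by (rule divide_right_mono) simp
        thus "1 / 2 - (real r + 1) / real n \<le> codegree_ratio r ?F n"
          using n r unfolding codegree_ratio_def by (simp add: diff_divide_distrib)
      qed
      show "\<forall>\<^sub>F n in sequentially. codegree_ratio r ?F n \<le> 1 / 2"
        unfolding eventually_sequentially
      proof (intro exI allI impI)
        fix n assume n: "r \<le> n"
        have "2 * codegree_ex r n ?F \<le> n"
          by (rule codegree_ex_bound[OF r n]) (rule not_free_of_codegree_gt_half[OF _ assms])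
        thus "codegree_ratio r ?F n \<le> 1 / 2"
          using n r unfolding codegree_ratio_def by (simp add: divide_le_eq)
      qed
      show "(\<lambda>n. 1 / 2 - (real r + 1) / real n) \<longlonglongrightarrow> 1 / 2"
        by real_asymp
    qed simp
    thus ?thesis using lim LIMSEQ_unique by blast
  qed
  have third: "codegree_density r ?F \<le> 1 / 3" if d: "odd (r div gcd r k)"
  proof (rule LIMSEQ_le_const2[OF lim], intro exI allI impI)
    fix n assume n: "r \<le> n"
    have "3 * codegree_ex r n ?F \<le> n"
      by (rule codegree_ex_bound[OF r n]) (rule not_free_of_codegree_gt_third[OF _ assms _ _ d])
    thus "codegree_ratio r ?F n \<le> 1 / 3"
      using n r unfolding codegree_ratio_def by (simp add: divide_le_eq)
  qed
  show ?thesis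
    using conv half third all_odd_available_iff[OF r] by presburger
qed

end
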